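(* The unit vector basis $(u_n)_n$ in the Maurey–Rosenthal space $Z_{MR}$ is a weakly null sequence with no RUD subsequences.
   Context: RUD: for vectors $y_1,\dots,y_n$ put $\mathbb E_\varepsilon\|\sum_{i=1}^n\varepsilon_iy_i\|=2^{-n}\sum_{\varepsilon\in\{-1,1\}^n}\|\sum_{i=1}^n\varepsilon_iy_i\|$. A basic sequence $(x_n)_n$ is RUD if there is a constant $C$ such that $\|\sum_{i=1}^na_ix_i\|\le C\,\mathbb E_\varepsilon\|\sum_{i=1}^n\varepsilon_ia_ix_i\|$ for all $n$ and all scalars $(a_i)_{i=1}^n$. The space $Z_{MR}$: fix $\delta\in(0,1)$ and an increasing sequence of positive integers $M=\{m_n\}_{n\ge1}$ such that $\sum_j\sum_{k\ne j}\sqrt{\min\{m_j/m_k,\,m_k/m_j\}}\le\delta$. Let $\mathbb N^{<\infty}$ be the collection of finite subsets of $\mathbb N$, write $\sharp s$ for the cardinality of $s$, write $s<t$ if $\max s<\min t$, and let $\mathcal S=\{s\in\mathbb N^{<\infty}:\sharp s\le\min s\}$ be the Schreier family. Fix a one-to-one function $\sigma:\mathbb N^{<\infty}\to\{m_k\}_{k\ge2}$ with $\sigma(s)>\sharp s$ for all $s$. Let $\mathcal B_0$ be the set of finite sequences $(s_1,\dots,s_n)$ of finite subsets of $\mathbb N$ such that $s_1\in\mathcal S$, $s_1<\dots<s_n$, $\sharp s_j\in M$ for all $j$, and $\sharp s_{i+1}=\sigma(s_1\cup\dots\cup s_i)>\sharp s_i$ for all $i<n$. Let $u_n$ be the $n$-th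 unit vector of $c_{00}$, $u_n^*$ its biorthogonal functional, and $$\mathcal N_0=\Big\{\sum_{i=1}^n\frac1{\sqrt{\sharp s_i}}\sum_{j\in s_i}u_j^*:(s_1,\dots,s_n)\in\mathcal B_0\Big\}.$$ Then $Z_{MR}$ is the space of scalar sequences $(a_n)_n$ with $$\|(a_n)_n\|_{Z_{MR}}=\max\Big\{\sup_{\phi\in\mathcal N_0}\Big|\Big\langle\phi,\sum_na_nu_n\Big\rangle\Big|,\ \sup_n|a_n|\Big\}<\infty.$$ *)

theory Defs
  imports Complex_Main "HOL-Library.FuncSet" "HOL-Library.Extended_Nonnegative_Real"
begin

text \<open>
  The scalars range over a type of class \<open>real_normed_field\<close>; by the Gelfand--Mazur theorem
  such a type is the field of real or of complex numbers.

  The norm of the Maurey--Rosenthal space depends on parameters, so normed spaces of scalar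
  sequences are given by a carrier \<open>V\<close> and a norm \<open>N\<close>, and the notions below are relative to
  these two. Sequences are indexed from 0: the index \<open>n :: nat\<close> stands for the positive
  integer \<open>n + 1\<close>.
\<close>

definition lin_comb ::
    "nat \<Rightarrow> (nat \<Rightarrow> 'a) \<Rightarrow> (nat \<Rightarrow> nat \<Rightarrow> 'a) \<Rightarrow> nat \<Rightarrow> 'a::real_normed_field" where
  "lin_comb n a x = (\<lambda>k. \<Sum>i<n. a i * x i k)"

definition dual_space ::
    "(nat \<Rightarrow> 'a) set \<Rightarrow> ((nat \<Rightarrow> 'a) \<Rightarrow> real) \<Rightarrow> ((nat \<Rightarrow> 'a) \<Rightarrow> 'a::real_normed_field) set" where
  "dual_space V N = {f.
     (\<forall>v\<in>V. \<forall>w\<in>V. f (\<lambda>k. v k + w k) = f v + f w) \<and>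
     (\<forall>c. \<forall>v\<in>V. f (\<lambda>k. c * v k) = c * f v) \<and>
     (\<exists>K. \<forall>v\<in>V. norm (f v) \<le> K * N v)}"

definition weakly_null ::
    "(nat \<Rightarrow> 'a) set \<Rightarrow> ((nat \<Rightarrow> 'a) \<Rightarrow> real) \<Rightarrow> (nat \<Rightarrow> nat \<Rightarrow> 'a::real_normed_field) \<Rightarrow> bool" where
  "weakly_null V N x \<longleftrightarrow>
     (\<forall>n. x n \<in> V) \<and> (\<forall>f\<in>dual_space V N. (\<lambda>n. f (x n)) \<longlonglongrightarrow> 0)"

definition closed_span ::
    "(nat \<Rightarrow> 'a) set \<Rightarrow> ((nat \<Rightarrow> 'a) \<Rightarrow> real) \<Rightarrow> (nat \<Rightarrow> nat \<Rightarrow> 'a::real_normed_field)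
     \<Rightarrow> (nat \<Rightarrow> 'a) set" where
  "closed_span V N x = {v\<in>V. \<forall>e>0. \<exists>n a. N (\<lambda>k. v k - lin_comb n a x k) < e}"

text \<open>A basic sequence is a Schauder basis of its closed linear span.\<close>

definition basic_sequence ::
    "(nat \<Rightarrow> 'a) set \<Rightarrow> ((nat \<Rightarrow> 'a) \<Rightarrow> real) \<Rightarrow> (nat \<Rightarrow> nat \<Rightarrow> 'a::real_normed_field) \<Rightarrow> bool" where
  "basic_sequence V N x \<longleftrightarrow>
     (\<forall>n. x n \<in> V) \<and>
     (\<forall>v\<in>closed_span V N x. \<exists>!a. (\<lambda>n. N (\<lambda>k. v k - lin_comb n a x k)) \<longlonglongrightarrow> 0)"

definition sign_average ::
    "((nat \<Rightarrow> 'a) \<Rightarrow> real) \<Rightarrow> nat \<Rightarrow> (nat \<Rightarrow> nat \<Rightarrow> 'a::real_normed_field) \<Rightarrow> real" where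
  "sign_average N n y = (\<Sum>\<epsilon>\<in>PiE {..<n} (\<lambda>_. {-1, 1}). N (lin_comb n \<epsilon> y)) / 2 ^ n"

definition RUD ::
    "(nat \<Rightarrow> 'a) set \<Rightarrow> ((nat \<Rightarrow> 'a) \<Rightarrow> real) \<Rightarrow> (nat \<Rightarrow> nat \<Rightarrow> 'a::real_normed_field) \<Rightarrow> bool" where
  "RUD V N x \<longleftrightarrow>
     basic_sequence V N x \<and>
     (\<exists>C. \<forall>n a. N (lin_comb n a x) \<le> C * sign_average N n (\<lambda>i k. a i * x i k))"

text \<open>
  In the Schreier condition \<open>card s \<le> min s\<close> the minimum is that of a set of positive
  integers, hence the successor.
\<close>

definition schreier :: "nat set set" where
  "schreier = {s. finite s \<and> card s \<le> Suc (Min s)}"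

text \<open>
  \<open>m 0, m 1, \<dots>\<close> are the elements of \<open>M\<close>. All members of a list in \<open>MR_lists m \<sigma>\<close> are nonempty
  if all \<open>m n\<close> are positive, so \<open>Max\<close> and \<open>Min\<close> are only taken of nonempty finite sets.
\<close>

definition MR_lists :: "(nat \<Rightarrow> nat) \<Rightarrow> (nat set \<Rightarrow> nat) \<Rightarrow> nat set list set" where
  "MR_lists m \<sigma> = {ss. ss \<noteq> [] \<and> hd ss \<in> schreier \<and>
     (\<forall>s\<in>set ss. finite s \<and> card s \<in> range m) \<and>
     (\<forall>i. Suc i < length ss \<longrightarrow>
        Max (ss ! i) < Min (ss ! Suc i) \<and>
        card (ss ! Suc i) = \<sigma> (\<Union>(set (take (Suc i) ss))) \<and>
        card (ss ! Suc i) > card (ss ! i))}"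

definition MR_functionals ::
    "(nat \<Rightarrow> nat) \<Rightarrow> (nat set \<Rightarrow> nat) \<Rightarrow> ((nat \<Rightarrow> 'a) \<Rightarrow> 'a::real_normed_field) set" where
  "MR_functionals m \<sigma> =
     (\<lambda>ss a. \<Sum>s\<leftarrow>ss. (1 / sqrt (real (card s))) *\<^sub>R (\<Sum>j\<in>s. a j)) ` MR_lists m \<sigma>"

definition MR_space ::
    "(nat \<Rightarrow> nat) \<Rightarrow> (nat set \<Rightarrow> nat) \<Rightarrow> (nat \<Rightarrow> 'a::real_normed_field) set" where
  "MR_space m \<sigma> = {a. bdd_above ((\<lambda>\<phi>. norm (\<phi> a)) ` MR_functionals m \<sigma>) \<and>
                        bdd_above (range (\<lambda>n. norm (a n)))}"

definition MR_norm ::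
    "(nat \<Rightarrow> nat) \<Rightarrow> (nat set \<Rightarrow> nat) \<Rightarrow> (nat \<Rightarrow> 'a::real_normed_field) \<Rightarrow> real" where
  "MR_norm m \<sigma> a = max (SUP \<phi>\<in>MR_functionals m \<sigma>. norm (\<phi> a)) (SUP n. norm (a n))"

definition unit_vec :: "nat \<Rightarrow> nat \<Rightarrow> 'a::real_normed_field" where
  "unit_vec n = (\<lambda>k. if k = n then 1 else 0)"

end

theory Submission
  imports Defs
begin

text \<open>
  The norm is a supremum over functionals \<open>\<phi>\<close> given by lists \<open>(s\<^sub>1, \<dots>, s\<^sub>n)\<close> of finite sets; on
  \<open>s\<^sub>i\<close> the coefficients of \<open>\<phi>\<close> are \<open>1 / sqrt (card s\<^sub>i)\<close>. The sizes in a list are distinct elements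
  of \<open>M\<close>, which is so sparse that \<open>\<Sum>p\<in>M. 1 / sqrt p \<le> 2\<close> and that normalised indicators of sets
  with different sizes in \<open>M\<close> are nearly orthogonal, with total error at most 1.

  The unit vectors are a monotone basis of their closed span: if a functional is cut off at \<open>n\<close>,
  the one set of its list that is cut can be filled up to its old size by far away indices, where
  a given vector of the closed span is as small as desired. This gives an admissible list again
  (\<open>norm_truncation_functional_le\<close>).

  They are weakly null because a vector with coordinates of modulus at most 1 supported on \<open>A\<close> has
  norm \<open>o(card A)\<close>, uniformly in \<open>A\<close> (\<open>MR_norm_le_epsilon_card\<close>), whereas a functional that stays
  away from 0 on infinitely many \<open>u\<^sub>n\<close> would be of order \<open>card A\<close> on suitable such vectors.

  No subsequence is RUD. In any infinite set of indices there are admissible lists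
  \<open>(s\<^sub>1, \<dots>, s\<^sub>n)\<close> of any length. Let \<open>x = \<Sum>i. 1\<^bsub>s\<^sub>i\<^esub> / sqrt (card s\<^sub>i)\<close>. The functional of the
  list itself has value at least \<open>n\<close> at \<open>x\<close>. Now let \<open>\<epsilon>x\<close> be \<open>x\<close> with signs, and pair it with
  the functional of another list \<open>(t\<^sub>1, \<dots>, t\<^sub>k)\<close>. The pairs \<open>s\<^sub>i, t\<^sub>l\<close> of different sizes contribute
  at most 1. If \<open>s\<^sub>i\<close> and \<open>t\<^sub>l\<close> have the same size, then injectivity of \<open>\<sigma>\<close> forces
  \<open>s\<^sub>i = t\<^sub>l\<close>, except when \<open>i\<close> or \<open>l\<close> is the first index or \<open>i\<close> is the last such index
  (\<open>matched_sets_eq\<close>). Each exception costs at most 1, and a pair \<open>s\<^sub>i = t\<^sub>l\<close> contributes the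
  modulus of the average of \<open>\<epsilon>\<close> over \<open>s\<^sub>i\<close>. Therefore
  \<open>\<parallel>\<epsilon>x\<parallel> \<le> 4 + \<Sum>i. \<bar>\<Sum>j\<in>s\<^sub>i. \<epsilon>\<^sub>j\<bar> / card s\<^sub>i\<close> (\<open>MR_norm_signed_block_vector_le\<close>). The average over
  all \<open>\<epsilon>\<close> of the \<open>i\<close>-th summand is at most \<open>1 / sqrt (card s\<^sub>i)\<close>, so the average of \<open>\<parallel>\<epsilon>x\<parallel>\<close> is at
  most 6, while \<open>\<parallel>x\<parallel> \<ge> n\<close>.
\<close>

section \<open>Sums over sign vectors\<close>

text \<open>
  Orthogonality of independent variables of mean zero: for \<open>i \<noteq> j\<close> the sum over all vectors is a
  product of sums over single coordinates, and the factor at \<open>i\<close> vanishes.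
\<close>

lemma sum_sign_products:
  fixes g :: "'b \<Rightarrow> real"
  assumes "finite I" "i \<in> I" "j \<in> I" and S: "finite S" "(\<Sum>x\<in>S. g x) = 0" "\<And>x. x \<in> S \<Longrightarrow> g x * g x = 1"
  shows "(\<Sum>\<epsilon>\<in>PiE I (\<lambda>_. S). g (\<epsilon> i) * g (\<epsilon> j)) = (if i = j then card S ^ card I else 0)"
proof (cases "i = j")
  case True
  have "(\<Sum>\<epsilon>\<in>PiE I (\<lambda>_. S). g (\<epsilon> i) * g (\<epsilon> j)) = (\<Sum>\<epsilon>\<in>PiE I (\<lambda>_. S). 1)"
    using assms True by (intro sum.cong) (auto simp: PiE_iff)
  then show ?thesis using True assms(1) by (simp add: card_PiE)
next
  case False
  define h where "h k x = (if k = i \<or> k = j then g x else 1)" for k x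
  have "(\<Sum>\<epsilon>\<in>PiE I (\<lambda>_. S). g (\<epsilon> i) * g (\<epsilon> j)) = (\<Sum>\<epsilon>\<in>PiE I (\<lambda>_. S). \<Prod>k\<in>I. h k (\<epsilon> k))"
  proof (intro sum.cong refl)
    fix \<epsilon>
    have "(\<Prod>k\<in>I. h k (\<epsilon> k)) = (\<Prod>k\<in>{i, j}. h k (\<epsilon> k))"
      using assms(1-3) by (intro prod.mono_neutral_right) (auto simp: h_def)
    then show "g (\<epsilon> i) * g (\<epsilon> j) = (\<Prod>k\<in>I. h k (\<epsilon> k))" using False by (simp add: h_def)
  qed
  also have "\<dots> = (\<Prod>k\<in>I. \<Sum>x\<in>S. h k x)"
    by (rule prod_sum_PiE[symmetric]) (use assms in auto)
  also have "\<dots> = 0"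
    using assms by (intro prod_zero bexI[of _ i]) (auto simp: h_def)
  finally show ?thesis using False by simp
qed

lemma minus_one_neq_one: "(-1 :: 'a::real_normed_field) \<noteq> 1"
proof
  assume "(-1 :: 'a) = 1"
  then have "(1 :: 'a) + 1 = 0" by (metis add.right_inverse)
  then show False by simp
qed

lemma card_sign_vectors:
  "finite I \<Longrightarrow> card (PiE I (\<lambda>_. {-1, 1 :: 'a::real_normed_field})) = 2 ^ card I"
  by (simp add: card_PiE minus_one_neq_one numeral_2_eq_2)

text \<open>
  The square function has mean \<open>card T\<close> by orthogonality. The passage from the second moment to the
  first is made pointwise, by the inequality between the arithmetic and the geometric mean. A sum of
  signs is the image of a real number, so the norm of the field can be computed in the reals.
\<close>

lemma sum_norm_sign_sum_le:
  assumes I: "finite I" and T: "T \<subseteq> I"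
  shows "(\<Sum>\<epsilon>\<in>PiE I (\<lambda>_. {-1, 1 :: 'a::real_normed_field}). norm (\<Sum>i\<in>T. \<epsilon> i))
    \<le> 2 ^ card I * sqrt (real (card T))"
proof (cases "T = {}")
  case False
  let ?E = "PiE I (\<lambda>_. {-1, 1 :: 'a})"
  \<comment> \<open>the real number behind a sign of the field\<close>
  define g :: "'a \<Rightarrow> real" where "g x = (if x = 1 then 1 else -1)" for x
  have "finite T" using T I finite_subset by blast
  then have t: "0 < card T" using False by (simp add: card_gt_0_iff)
  have fin: "finite ?E" using I by (intro finite_PiE) auto
  have card: "card ?E = 2 ^ card I" using I by (rule card_sign_vectors)
  have norm_eq: "norm (\<Sum>i\<in>T. \<epsilon> i) = \<bar>\<Sum>i\<in>T. g (\<epsilon> i)\<bar>" if "\<epsilon> \<in> ?E" for \<epsilon>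
  proof -
    have "(\<Sum>i\<in>T. \<epsilon> i) = (\<Sum>i\<in>T. of_real (g (\<epsilon> i)))"
      using that T by (intro sum.cong) (auto simp: g_def PiE_iff)
    also have "\<dots> = of_real (\<Sum>i\<in>T. g (\<epsilon> i))" by simp
    finally show ?thesis by (simp only: norm_of_real)
  qed
  have "(\<Sum>\<epsilon>\<in>?E. (\<Sum>i\<in>T. g (\<epsilon> i))\<^sup>2) = (\<Sum>\<epsilon>\<in>?E. \<Sum>i\<in>T. \<Sum>j\<in>T. g (\<epsilon> i) * g (\<epsilon> j))"
    by (simp add: power2_eq_square sum_product)
  also have "\<dots> = (\<Sum>i\<in>T. \<Sum>j\<in>T. \<Sum>\<epsilon>\<in>?E. g (\<epsilon> i) * g (\<epsilon> j))"
    by (subst sum.swap, rule sum.cong[OF refl], rule sum.swap)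
  also have "\<dots> = (\<Sum>i\<in>T. \<Sum>j\<in>T. if i = j then 2 ^ card I else 0)"
  proof (intro sum.cong refl)
    fix i j assume "i \<in> T" "j \<in> T"
    then show "(\<Sum>\<epsilon>\<in>?E. g (\<epsilon> i) * g (\<epsilon> j)) = (if i = j then 2 ^ card I else 0)"
      using T I minus_one_neq_one by (subst sum_sign_products) (auto simp: g_def numeral_2_eq_2)
  qed
  also have "\<dots> = card T * 2 ^ card I" using \<open>finite T\<close> by simp
  finally have sq: "(\<Sum>\<epsilon>\<in>?E. (\<Sum>i\<in>T. g (\<epsilon> i))\<^sup>2) = card T * 2 ^ card I" .
  have amgm: "\<bar>x\<bar> \<le> (x\<^sup>2 / sqrt (card T) + sqrt (card T)) / 2" for x :: real
  proof -
    have "0 \<le> (\<bar>x\<bar> - sqrt (card T))\<^sup>2" by simp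
    then have "2 * \<bar>x\<bar> * sqrt (card T) \<le> x\<^sup>2 + sqrt (card T) * sqrt (card T)"
      by (simp add: power2_diff)
    then show ?thesis using t by (simp add: field_simps)
  qed
  have "(\<Sum>\<epsilon>\<in>?E. norm (\<Sum>i\<in>T. \<epsilon> i)) = (\<Sum>\<epsilon>\<in>?E. \<bar>\<Sum>i\<in>T. g (\<epsilon> i)\<bar>)"
    by (intro sum.cong norm_eq refl)
  also have "\<dots> \<le> (\<Sum>\<epsilon>\<in>?E. ((\<Sum>i\<in>T. g (\<epsilon> i))\<^sup>2 / sqrt (card T) + sqrt (card T)) / 2)"
    by (intro sum_mono amgm)
  also have "\<dots> = ((\<Sum>\<epsilon>\<in>?E. (\<Sum>i\<in>T. g (\<epsilon> i))\<^sup>2) / sqrt (card T) + 2 ^ card I * sqrt (card T)) / 2"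
    by (simp add: sum.distrib card flip: sum_divide_distrib)
  also have "\<dots> = ((card T * 2 ^ card I) / sqrt (card T) + 2 ^ card I * sqrt (card T)) / 2"
    by (simp only: sq)
  also have "\<dots> = 2 ^ card I * sqrt (card T)"
    using t by (simp add: field_simps)
  finally show ?thesis .
qed simp

section \<open>Finite sets and sums\<close>

text \<open>
  The source of all sets with prescribed size: both the sets of new lists and the far away indices
  that replace the cut off part of a set.
\<close>

lemma finite_subset_beyond:
  fixes R :: "nat set"
  assumes "infinite R"
  obtains t where "t \<subseteq> R" "finite t" "card t = p" "\<And>x. x \<in> t \<Longrightarrow> b < x"
proof -
  have "R \<subseteq> (R \<inter> {b<..}) \<union> {..b}" by auto
  then have "infinite (R \<inter> {b<..})"
    using assms finite_subset by blast
  then obtain t where "finite t" "card t = p" "t \<subseteq> R \<inter> {b<..}"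
    using infinite_arbitrarily_large by metis
  then show thesis by (intro that[of t]) auto
qed

text \<open>
  Two initial segments of the same linearly ordered set are comparable by inclusion.
\<close>

lemma initial_segments_eq:
  fixes A B D :: "'a::linorder set"
  assumes "A \<subseteq> D" "B \<subseteq> D" "finite A" "finite B" "card A = card B"
    and A: "\<And>x y. x \<in> D \<Longrightarrow> y \<in> A \<Longrightarrow> x < y \<Longrightarrow> x \<in> A"
    and B: "\<And>x y. x \<in> D \<Longrightarrow> y \<in> B \<Longrightarrow> x < y \<Longrightarrow> x \<in> B"
  shows "A = B"
proof (cases "A \<subseteq> B")
  case True
  then show ?thesis using assms by (intro card_subset_eq)
next
  case False
  then obtain x where x: "x \<in> A" "x \<notin> B" by auto
  have "B \<subseteq> A"
  proof
    fix y assume y: "y \<in> B"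
    then show "y \<in> A"
      using A[of y x] B[of x y] x assms(1,2) by (cases x y rule: linorder_cases) auto
  qed
  then show ?thesis using assms card_subset_eq[of A B] by simp
qed

lemma mem_Union_take: "x \<in> \<Union>(set (take i ss)) \<longleftrightarrow> (\<exists>h<i. h < length ss \<and> x \<in> ss ! h)"
  by (auto simp: set_conv_nth)

text \<open>
  At most one index of \<open>L\<close> is matched with \<open>p\<close>.
\<close>

lemma sum_matched_le:
  fixes c :: real
  assumes "finite L" "inj_on q L" "0 \<le> c"
  shows "(\<Sum>l\<in>L. if p = q l then c else 0) \<le> c"
proof (cases "\<exists>l\<in>L. p = q l")
  case True
  then obtain l0 where "l0 \<in> L" "p = q l0" by auto
  then have "(\<Sum>l\<in>L. if p = q l then c else 0) = (\<Sum>l\<in>L. if l = l0 then c else 0)"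
    using assms(2) by (intro sum.cong) (auto dest: inj_onD)
  then show ?thesis using assms by simp
next
  case False
  then have "(\<Sum>l\<in>L. if p = q l then c else 0) = 0" by (intro sum.neutral) auto
  then show ?thesis using assms by simp
qed

section \<open>Functionals and linear combinations of unit vectors\<close>

definition list_functional :: "nat set list \<Rightarrow> (nat \<Rightarrow> 'a) \<Rightarrow> 'a::real_normed_field" where
  "list_functional ss a = (\<Sum>s\<leftarrow>ss. (1 / sqrt (real (card s))) *\<^sub>R (\<Sum>j\<in>s. a j))"

lemma MR_functionals_eq: "MR_functionals m \<sigma> = list_functional ` MR_lists m \<sigma>"
  unfolding MR_functionals_def list_functional_def[abs_def] ..

lemma list_functional_Nil [simp]: "list_functional [] a = 0"
  and list_functional_snoc [simp]: "list_functional (ss @ [t]) a =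
    list_functional ss a + (1 / sqrt (real (card t))) *\<^sub>R (\<Sum>j\<in>t. a j)"
  by (simp_all add: list_functional_def)

lemma list_functional_nth: "list_functional ss a =
    (\<Sum>i<length ss. (1 / sqrt (real (card (ss ! i)))) *\<^sub>R (\<Sum>j\<in>ss ! i. a j))"
  unfolding list_functional_def sum_list_sum_nth
  by (simp add: atLeast0LessThan)

lemma list_functional_add:
    "list_functional ss (\<lambda>k. a k + b k) = list_functional ss a + list_functional ss b"
  and list_functional_mult: "list_functional ss (\<lambda>k. c * a k) = c * list_functional ss a"
proof (induction ss rule: rev_induct)
  case Nil
  { case 1 show ?case by simp }
  { case 2 show ?case by simp }
next
  case (snoc t ss)
  { case 1 then show ?case by (simp add: snoc sum.distrib scaleR_add_right) }
  { case 2 then show ?case by (simp add: snoc sum_distrib_left[symmetric] algebra_simps) }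
qed

lemma list_functional_cong:
  assumes "\<And>s x. s \<in> set ss \<Longrightarrow> x \<in> s \<Longrightarrow> a x = b x"
  shows "list_functional ss a = list_functional ss b"
  unfolding list_functional_def
  by (rule arg_cong[where f = sum_list], rule map_cong[OF refl])
     (simp add: assms cong: sum.cong)

lemma lin_comb_unit_vec: "lin_comb n a unit_vec k = (if k < n then a k else 0)"
proof -
  have "lin_comb n a unit_vec k = (\<Sum>i<n. if i = k then a i else 0)"
    unfolding lin_comb_def unit_vec_def by (intro sum.cong) auto
  then show ?thesis by simp
qed

lemma lin_comb_unit_vec_subseq:
  assumes "inj r"
  shows "lin_comb N b (\<lambda>i. unit_vec (r i)) k = (if k \<in> r ` {..<N} then b (inv r k) else 0)"
proof (cases "k \<in> range r")
  case True
  then obtain i where i: "k = r i" by auto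
  have "lin_comb N b (\<lambda>i. unit_vec (r i)) k = (\<Sum>j<N. if j = i then b j else 0)"
    unfolding lin_comb_def unit_vec_def using assms by (intro sum.cong) (auto simp: i inj_eq)
  then show ?thesis using assms by (auto simp: i inj_eq image_iff)
next
  case False
  then have "lin_comb N b (\<lambda>i. unit_vec (r i)) k = 0"
    unfolding lin_comb_def unit_vec_def by (intro sum.neutral) auto
  then show ?thesis using False by auto
qed

lemma dual_space_add:
    "f \<in> dual_space V N \<Longrightarrow> v \<in> V \<Longrightarrow> w \<in> V \<Longrightarrow> f (\<lambda>k. v k + w k) = f v + f w"
  and dual_space_mult: "f \<in> dual_space V N \<Longrightarrow> v \<in> V \<Longrightarrow> f (\<lambda>k. c * v k) = c * f v"
  by (simp_all add: dual_space_def)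

section \<open>The admissible lists of sets\<close>

locale maurey_rosenthal =
  fixes m :: "nat \<Rightarrow> nat" and \<sigma> :: "nat set \<Rightarrow> nat"
  assumes m_mono: "strict_mono m" and m_pos: "\<And>n. 0 < m n"
    and gap: "(\<Sum>j. \<Sum>k. if k = j then 0
            else ennreal (sqrt (min (real (m j) / real (m k)) (real (m k) / real (m j))))) \<le> 1"
    and \<sigma>_inj: "inj_on \<sigma> {s. finite s}"
    and \<sigma>_range: "\<And>s. finite s \<Longrightarrow> \<sigma> s \<in> range m"
    and \<sigma>_card: "\<And>s. finite s \<Longrightarrow> card s < \<sigma> s"
begin

text \<open>
  For \<open>p \<noteq> q\<close> this bounds the inner product of the \<open>\<ell>\<^sup>2\<close>-normalised indicator functions of two
  sets of sizes \<open>p\<close> and \<open>q\<close>. It vanishes on the diagonal so that its sum over all pairs of sizes is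
  the double series of the hypothesis.
\<close>

definition closeness :: "nat \<Rightarrow> nat \<Rightarrow> real" where
  "closeness p q = (if q = p then 0 else sqrt (min (real p / real q) (real q / real p)))"

lemma closeness_nonneg: "0 \<le> closeness p q"
  by (simp add: closeness_def)

lemma sum_closeness_le_1:
  assumes "finite P" "finite Q" "P \<subseteq> range m" "Q \<subseteq> range m"
  shows "(\<Sum>p\<in>P. \<Sum>q\<in>Q. closeness p q) \<le> 1"
proof -
  obtain J where J: "P = m ` J" "finite J" "inj_on m J"
    using assms(1,3) m_mono
    by (metis finite_imageD strict_mono_imp_inj_on inj_on_subset subset_UNIV subset_image_iff)
  obtain K where K: "Q = m ` K" "finite K" "inj_on m K"
    using assms(2,4) m_mono
    by (metis finite_imageD strict_mono_imp_inj_on inj_on_subset subset_UNIV subset_image_iff)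
  have inj: "inj m" using m_mono by (rule strict_mono_imp_inj_on)
  have "ennreal (\<Sum>j\<in>J. \<Sum>k\<in>K. closeness (m j) (m k))
      = (\<Sum>j\<in>J. \<Sum>k\<in>K. ennreal (closeness (m j) (m k)))"
    by (simp add: closeness_nonneg sum_nonneg flip: sum_ennreal)
  also have "\<dots> \<le> (\<Sum>j\<in>J. \<Sum>k. ennreal (closeness (m j) (m k)))"
    by (intro sum_mono sum_le_suminf) (auto simp: K)
  also have "\<dots> \<le> (\<Sum>j. \<Sum>k. ennreal (closeness (m j) (m k)))"
    by (intro sum_le_suminf) (auto simp: J)
  also have "\<dots> \<le> 1"
    using gap inj by (simp add: closeness_def inj_eq if_distrib[of ennreal] cong: if_cong)
  finally have "(\<Sum>j\<in>J. \<Sum>k\<in>K. closeness (m j) (m k)) \<le> 1"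
    by simp
  then show ?thesis
    using J K by (simp add: sum.reindex)
qed

text \<open>
  This is the row of \<open>m 0\<close> in the double series: \<open>1 / p \<le> m 0 / p\<close>, so the sizes other
  than \<open>m 0\<close> add up to at most 1, and \<open>m 0\<close> itself adds at most 1.
\<close>

lemma sum_inverse_sqrt_le_2:
  assumes "finite P" "P \<subseteq> range m"
  shows "(\<Sum>p\<in>P. 1 / sqrt (real p)) \<le> 2"
proof -
  have "1 / sqrt (real p) \<le> (if p = m 0 then 1 else 0) + closeness (m 0) p" if p: "p \<in> P" for p
  proof -
    obtain k where k: "p = m k" using p assms(2) by blast
    have le: "m 0 \<le> p" "1 \<le> m 0"
      using m_mono m_pos[of 0] by (auto simp: k strict_mono_less_eq)
    then have r: "1 \<le> real (m 0)" "real (m 0) \<le> real p" by auto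
    then have "1 / real p \<le> real (m 0) / real p" "real (m 0) / real p \<le> 1" "1 \<le> real p / real (m 0)"
      by (auto simp: field_simps)
    then have "sqrt (1 / real p) \<le> sqrt (min (real (m 0) / real p) (real p / real (m 0)))"
      by (intro real_sqrt_le_mono) linarith
    moreover have "1 / sqrt (real p) \<le> 1" using r by simp
    ultimately show ?thesis using r by (auto simp: closeness_def real_sqrt_divide)
  qed
  then have "(\<Sum>p\<in>P. 1 / sqrt (real p)) \<le> (\<Sum>p\<in>P. (if p = m 0 then 1 else 0) + closeness (m 0) p)"
    by (rule sum_mono)
  also have "\<dots> = (\<Sum>p\<in>P. if p = m 0 then 1 else 0) + (\<Sum>p\<in>{m 0}. \<Sum>q\<in>P. closeness p q)"
    by (simp add: sum.distrib)
  also have "\<dots> \<le> 1 + 1"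
    by (intro add_mono sum_closeness_le_1) (use assms in auto)
  finally show ?thesis by simp
qed

lemma MR_lists_nth:
  assumes "ss \<in> MR_lists m \<sigma>" "i < length ss"
  shows "finite (ss ! i)" "card (ss ! i) \<in> range m" "0 < card (ss ! i)" "ss ! i \<noteq> {}"
proof -
  show 1: "finite (ss ! i)" "card (ss ! i) \<in> range m"
    using assms by (auto simp: MR_lists_def)
  then show "0 < card (ss ! i)" using m_pos by auto
  then show "ss ! i \<noteq> {}" by auto
qed

lemma MR_lists_card_less:
  assumes "ss \<in> MR_lists m \<sigma>" "i < j" "j < length ss"
  shows "card (ss ! i) < card (ss ! j)"
  using assms(2,3)
proof (induction j)
  case (Suc j)
  then have "card (ss ! j) < card (ss ! Suc j)"
    using assms(1) by (auto simp: MR_lists_def)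
  then show ?case using Suc by (cases "i = j") auto
qed simp

lemma MR_lists_less:
  assumes "ss \<in> MR_lists m \<sigma>" "i < j" "j < length ss" "x \<in> ss ! i" "y \<in> ss ! j"
  shows "x < y"
  using assms(2,3,5)
proof (induction j arbitrary: y)
  case (Suc j)
  have ne: "finite (ss ! j)" "ss ! j \<noteq> {}" "finite (ss ! Suc j)"
    using MR_lists_nth assms(1) Suc by auto
  have "Max (ss ! j) < Min (ss ! Suc j)"
    using assms(1) Suc by (auto simp: MR_lists_def)
  moreover have "Min (ss ! Suc j) \<le> y" using ne Suc by auto
  moreover have "x \<le> Max (ss ! j)"
  proof (cases "i = j")
    case True then show ?thesis using assms(4) ne by auto
  next
    case False
    then have "x < Max (ss ! j)" using Suc ne by (intro Suc.IH) auto
    then show ?thesis by simp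
  qed
  ultimately show ?case by simp
qed simp

lemma MR_lists_card_eq:
  assumes "ss \<in> MR_lists m \<sigma>" "0 < i" "i < length ss"
  shows "card (ss ! i) = \<sigma> (\<Union>(set (take i ss)))"
  using assms by (cases i) (auto simp: MR_lists_def)

text \<open>
  The new size is automatically in \<open>M\<close> and larger than the last one, because \<open>\<sigma>\<close> has values in
  \<open>M\<close> and \<open>\<sigma> U > card U\<close>.
\<close>

lemma MR_lists_snocI:
  assumes ss: "ss \<in> MR_lists m \<sigma>" and t: "finite t" "card t = \<sigma> (\<Union>(set ss))"
    and less: "\<And>x y. x \<in> \<Union>(set ss) \<Longrightarrow> y \<in> t \<Longrightarrow> x < y"
  shows "ss @ [t] \<in> MR_lists m \<sigma>"
proof -
  have fin: "finite (\<Union>(set ss))" and ne: "ss \<noteq> []" using ss by (auto simp: MR_lists_def)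
  have gt: "card (last ss) < card t"
  proof -
    have "card (last ss) \<le> card (\<Union>(set ss))"
      using last_in_set[OF ne] by (intro card_mono[OF fin]) blast
    then show ?thesis using \<sigma>_card[OF fin] t by simp
  qed
  then have "t \<noteq> {}" by auto
  have "last ss \<noteq> {}" "finite (last ss)"
    using MR_lists_nth[OF ss, of "length ss - 1"] ne by (auto simp: last_conv_nth)
  then have "Max (last ss) < Min t"
    using less t \<open>t \<noteq> {}\<close> ne by (metis Max_in Min_in UnionI last_in_set)
  moreover have "card t \<in> range m" using \<sigma>_range fin t by simp
  ultimately have step: "Max ((ss @ [t]) ! i) < Min ((ss @ [t]) ! Suc i) \<and>
        card ((ss @ [t]) ! Suc i) = \<sigma> (\<Union>(set (take (Suc i) (ss @ [t])))) \<and>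
        card ((ss @ [t]) ! Suc i) > card ((ss @ [t]) ! i)" if "Suc i < length (ss @ [t])" for i
  proof (cases "Suc i < length ss")
    case True
    then have "Max (ss ! i) < Min (ss ! Suc i) \<and> card (ss ! Suc i) = \<sigma> (\<Union>(set (take (Suc i) ss))) \<and>
        card (ss ! Suc i) > card (ss ! i)"
      using ss unfolding MR_lists_def by blast
    then show ?thesis using True by (simp add: nth_append)
  next
    case False
    then have "length ss = Suc i" using that by simp
    then show ?thesis
      using \<open>Max (last ss) < Min t\<close> t gt ne by (simp add: nth_append last_conv_nth)
  qed
  have "hd ss \<in> schreier" "\<forall>s\<in>set ss. finite s \<and> card s \<in> range m"
    using ss by (simp_all add: MR_lists_def)
  then have "ss @ [t] \<noteq> []" "hd (ss @ [t]) \<in> schreier"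
    "\<forall>s\<in>set (ss @ [t]). finite s \<and> card s \<in> range m"
    using t \<open>card t \<in> range m\<close> ne by auto
  with step show ?thesis unfolding MR_lists_def mem_Collect_eq by blast
qed

lemma MR_lists_butlast:
  assumes "ss @ [t] \<in> MR_lists m \<sigma>" "ss \<noteq> []"
  shows "ss \<in> MR_lists m \<sigma>"
proof -
  have "Max (ss ! i) < Min (ss ! Suc i) \<and> card (ss ! Suc i) = \<sigma> (\<Union>(set (take (Suc i) ss))) \<and>
        card (ss ! Suc i) > card (ss ! i)" if "Suc i < length ss" for i
  proof -
    have "Suc i < length (ss @ [t])" using that by simp
    then have "Max ((ss @ [t]) ! i) < Min ((ss @ [t]) ! Suc i) \<and>
        card ((ss @ [t]) ! Suc i) = \<sigma> (\<Union>(set (take (Suc i) (ss @ [t])))) \<and>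
        card ((ss @ [t]) ! Suc i) > card ((ss @ [t]) ! i)"
      using assms(1) unfolding MR_lists_def by blast
    then show ?thesis using that by (simp add: nth_append)
  qed
  moreover have "hd ss \<in> schreier" "\<forall>s\<in>set ss. finite s \<and> card s \<in> range m"
    using assms by (simp_all add: MR_lists_def)
  ultimately show ?thesis using assms(2) unfolding MR_lists_def mem_Collect_eq by blast
qed

lemma MR_lists_snocD:
  assumes "ss @ [t] \<in> MR_lists m \<sigma>"
  shows "finite t" "0 < card t" "\<And>x y. x \<in> \<Union>(set ss) \<Longrightarrow> y \<in> t \<Longrightarrow> x < y"
    "ss \<noteq> [] \<Longrightarrow> card t = \<sigma> (\<Union>(set ss))"
proof -
  show "finite t" "0 < card t"
    using MR_lists_nth[OF assms, of "length ss"] by auto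
  show "x < y" if xy: "x \<in> \<Union>(set ss)" "y \<in> t" for x y
  proof -
    obtain i where "i < length ss" "x \<in> ss ! i"
      using xy(1) by (metis UnionE in_set_conv_nth)
    then show ?thesis
      using MR_lists_less[OF assms, of i "length ss" x y] xy by (simp add: nth_append)
  qed
  show "card t = \<sigma> (\<Union>(set ss))" if "ss \<noteq> []"
    using MR_lists_card_eq[OF assms, of "length ss"] that by simp
qed

lemma MR_lists_singleton:
  "[t] \<in> MR_lists m \<sigma> \<longleftrightarrow> t \<in> schreier \<and> finite t \<and> card t \<in> range m"
  by (auto simp: MR_lists_def)

lemma MR_lists_in_infinite_set:
  assumes "infinite R"
  shows "\<exists>ss\<in>MR_lists m \<sigma>. length ss = Suc n \<and> \<Union>(set ss) \<subseteq> R"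
proof (induction n)
  case 0
  \<comment> \<open>beyond \<open>m 0\<close>, a set of size \<open>m 0\<close> is in the Schreier family\<close>
  obtain t where t: "t \<subseteq> R" "finite t" "card t = m 0" "\<And>x. x \<in> t \<Longrightarrow> m 0 < x"
    using finite_subset_beyond[OF assms] by metis
  then have "t \<noteq> {}" using m_pos[of 0] by auto
  then have "m 0 < Min t" using t by simp
  then have "[t] \<in> MR_lists m \<sigma>" using t by (simp add: MR_lists_singleton schreier_def)
  then show ?case using t by (intro bexI[of _ "[t]"]) auto
next
  case (Suc n)
  then obtain ss where ss: "ss \<in> MR_lists m \<sigma>" "length ss = Suc n" "\<Union>(set ss) \<subseteq> R" by auto
  have fin: "finite (\<Union>(set ss))" using ss by (auto simp: MR_lists_def)
  obtain t where t: "t \<subseteq> R" "finite t" "card t = \<sigma> (\<Union>(set ss))"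
      "\<And>x. x \<in> t \<Longrightarrow> Max (\<Union>(set ss)) < x"
    using finite_subset_beyond[OF assms] by metis
  have "ss @ [t] \<in> MR_lists m \<sigma>"
    using ss t by (intro MR_lists_snocI) (auto intro: le_less_trans[OF Max_ge[OF fin]])
  then show ?case using ss t by (intro bexI[of _ "ss @ [t]"]) auto
qed

lemma MR_lists_ne: "MR_lists m \<sigma> \<noteq> {}"
  using MR_lists_in_infinite_set[of UNIV 0] by auto

lemma card_nth_inj_on:
  assumes "ss \<in> MR_lists m \<sigma>"
  shows "inj_on (\<lambda>i. card (ss ! i)) {..<length ss}"
proof (rule inj_onI)
  fix i j assume "i \<in> {..<length ss}" "j \<in> {..<length ss}" "card (ss ! i) = card (ss ! j)"
  then show "i = j"
    using MR_lists_card_less[OF assms, of i j] MR_lists_card_less[OF assms, of j i]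
    by (cases i j rule: linorder_cases) auto
qed

lemma sum_list_inverse_sqrt_le_2:
  assumes "ss \<in> MR_lists m \<sigma>"
  shows "(\<Sum>i<length ss. 1 / sqrt (real (card (ss ! i)))) \<le> 2"
proof -
  have "(\<Sum>p\<in>(\<lambda>i. card (ss ! i)) ` {..<length ss}. 1 / sqrt (real p)) \<le> 2"
    using MR_lists_nth[OF assms] by (intro sum_inverse_sqrt_le_2) auto
  then show ?thesis by (simp add: sum.reindex[OF card_nth_inj_on[OF assms]])
qed

section \<open>The normed space\<close>

lemma MR_norm_le:
  fixes a :: "nat \<Rightarrow> 'a::real_normed_field"
  assumes "\<And>ss. ss \<in> MR_lists m \<sigma> \<Longrightarrow> norm (list_functional ss a) \<le> B" "\<And>n. norm (a n) \<le> B"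
  shows "MR_norm m \<sigma> a \<le> B"
  unfolding MR_norm_def MR_functionals_eq
  using assms MR_lists_ne by (auto intro!: cSUP_least)

lemma MR_norm_ge:
  fixes a :: "nat \<Rightarrow> 'a::real_normed_field"
  assumes "a \<in> MR_space m \<sigma>"
  shows "ss \<in> MR_lists m \<sigma> \<Longrightarrow> norm (list_functional ss a) \<le> MR_norm m \<sigma> a"
    "norm (a n) \<le> MR_norm m \<sigma> a"
proof -
  have "norm (list_functional ss a) \<le> (SUP \<phi>\<in>MR_functionals m \<sigma>. norm (\<phi> a))"
    if "ss \<in> MR_lists m \<sigma>"
    using assms that
    by (intro cSUP_upper[of "list_functional ss" _ "\<lambda>\<phi>. norm (\<phi> a)"])
       (auto simp: MR_space_def MR_functionals_eq)
  then show "ss \<in> MR_lists m \<sigma> \<Longrightarrow> norm (list_functional ss a) \<le> MR_norm m \<sigma> a"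
    by (auto simp: MR_norm_def)
  have "norm (a n) \<le> (SUP n. norm (a n))"
    using assms by (intro cSUP_upper) (auto simp: MR_space_def)
  then show "norm (a n) \<le> MR_norm m \<sigma> a" by (simp add: MR_norm_def)
qed

lemma MR_norm_nonneg: "a \<in> MR_space m \<sigma> \<Longrightarrow> 0 \<le> MR_norm m \<sigma> a"
  using MR_norm_ge(2)[of a 0] norm_ge_zero[of "a 0"] by linarith

lemma MR_spaceI:
  fixes a :: "nat \<Rightarrow> 'a::real_normed_field"
  assumes "\<And>ss. ss \<in> MR_lists m \<sigma> \<Longrightarrow> norm (list_functional ss a) \<le> B" "\<And>n. norm (a n) \<le> B"
  shows "a \<in> MR_space m \<sigma>"
  using assms by (auto simp: MR_space_def MR_functionals_eq intro!: bdd_aboveI[where M = B])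

lemma MR_space_add:
    "v \<in> MR_space m \<sigma> \<Longrightarrow> w \<in> MR_space m \<sigma> \<Longrightarrow> (\<lambda>k. v k + w k) \<in> MR_space m \<sigma>"
  and MR_norm_triangle: "v \<in> MR_space m \<sigma> \<Longrightarrow> w \<in> MR_space m \<sigma> \<Longrightarrow>
    MR_norm m \<sigma> (\<lambda>k. v k + w k) \<le> MR_norm m \<sigma> v + MR_norm m \<sigma> w"
  for v w :: "nat \<Rightarrow> 'a::real_normed_field"
proof -
  assume vw: "v \<in> MR_space m \<sigma>" "w \<in> MR_space m \<sigma>"
  let ?B = "MR_norm m \<sigma> v + MR_norm m \<sigma> w"
  have 1: "norm (list_functional ss (\<lambda>k. v k + w k)) \<le> ?B" if "ss \<in> MR_lists m \<sigma>" for ss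
    unfolding list_functional_add
    by (rule norm_triangle_mono) (use MR_norm_ge vw that in auto)
  have 2: "norm (v n + w n) \<le> ?B" for n
    by (rule norm_triangle_mono) (use MR_norm_ge vw in auto)
  show "(\<lambda>k. v k + w k) \<in> MR_space m \<sigma>" using 1 2 by (rule MR_spaceI)
  show "MR_norm m \<sigma> (\<lambda>k. v k + w k) \<le> ?B" using 1 2 by (rule MR_norm_le)
qed

lemma MR_space_mult: "(\<lambda>k. c * v k) \<in> MR_space m \<sigma>"
  and MR_norm_mult_le: "MR_norm m \<sigma> (\<lambda>k. c * v k) \<le> norm c * MR_norm m \<sigma> v"
  if "v \<in> MR_space m \<sigma>" for v :: "nat \<Rightarrow> 'a::real_normed_field"
proof -
  have 1: "norm (list_functional ss (\<lambda>k. c * v k)) \<le> norm c * MR_norm m \<sigma> v"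
    if "ss \<in> MR_lists m \<sigma>" for ss
    unfolding list_functional_mult norm_mult
    by (rule mult_left_mono) (use MR_norm_ge \<open>v \<in> MR_space m \<sigma>\<close> that in auto)
  have 2: "norm (c * v n) \<le> norm c * MR_norm m \<sigma> v" for n
    unfolding norm_mult by (rule mult_left_mono) (use MR_norm_ge \<open>v \<in> MR_space m \<sigma>\<close> in auto)
  show "(\<lambda>k. c * v k) \<in> MR_space m \<sigma>" using 1 2 by (rule MR_spaceI)
  show "MR_norm m \<sigma> (\<lambda>k. c * v k) \<le> norm c * MR_norm m \<sigma> v" using 1 2 by (rule MR_norm_le)
qed

lemma MR_space_diff:
    "v \<in> MR_space m \<sigma> \<Longrightarrow> w \<in> MR_space m \<sigma> \<Longrightarrow> (\<lambda>k. v k - w k) \<in> MR_space m \<sigma>"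
  and MR_norm_diff: "v \<in> MR_space m \<sigma> \<Longrightarrow> w \<in> MR_space m \<sigma> \<Longrightarrow>
    MR_norm m \<sigma> (\<lambda>k. v k - w k) \<le> MR_norm m \<sigma> v + MR_norm m \<sigma> w"
  for v w :: "nat \<Rightarrow> 'a::real_normed_field"
  using MR_space_add[OF _ MR_space_mult, of v w "-1"]
    MR_norm_triangle[OF _ MR_space_mult, of v w "-1"] MR_norm_mult_le[of w "-1"]
  by (auto simp: MR_norm_nonneg)

lemma norm_list_functional_le:
  fixes a :: "nat \<Rightarrow> 'a::real_normed_field"
  shows "norm (list_functional ss a) \<le>
    (\<Sum>i<length ss. (\<Sum>j\<in>ss ! i. norm (a j)) / sqrt (real (card (ss ! i))))"
  unfolding list_functional_nth
  by (intro sum_norm_le) (simp add: divide_right_mono norm_sum)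

lemma unit_vec_in_MR_space: "(unit_vec n :: nat \<Rightarrow> 'a::real_normed_field) \<in> MR_space m \<sigma>"
proof (rule MR_spaceI)
  fix ss assume ss: "ss \<in> MR_lists m \<sigma>"
  have "norm (list_functional ss (unit_vec n :: nat \<Rightarrow> 'a)) \<le>
      (\<Sum>i<length ss. (\<Sum>j\<in>ss ! i. norm (unit_vec n j :: 'a)) / sqrt (real (card (ss ! i))))"
    by (rule norm_list_functional_le)
  also have "\<dots> \<le> (\<Sum>i<length ss. 1 / sqrt (real (card (ss ! i))))"
  proof (intro sum_mono divide_right_mono)
    fix i assume "i \<in> {..<length ss}"
    then have "finite (ss ! i)" using MR_lists_nth ss by auto
    then show "(\<Sum>j\<in>ss ! i. norm (unit_vec n j :: 'a)) \<le> 1"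
      by (simp add: unit_vec_def if_distrib[of norm] cong: if_cong)
  qed simp
  also have "\<dots> \<le> 2" using ss by (rule sum_list_inverse_sqrt_le_2)
  finally show "norm (list_functional ss (unit_vec n :: nat \<Rightarrow> 'a)) \<le> 2" .
qed (simp add: unit_vec_def)

lemma MR_space_sum:
  fixes x :: "'b \<Rightarrow> nat \<Rightarrow> 'a::real_normed_field"
  assumes "finite A" "\<And>j. j \<in> A \<Longrightarrow> x j \<in> MR_space m \<sigma>"
  shows "(\<lambda>k. \<Sum>j\<in>A. b j * x j k) \<in> MR_space m \<sigma>"
  using assms
proof (induction A rule: finite_induct)
  case empty
  show ?case by (rule MR_spaceI[of _ 0]) (auto simp: list_functional_def)
next
  case (insert j A)
  then have "(\<lambda>k. b j * x j k + (\<Sum>j\<in>A. b j * x j k)) \<in> MR_space m \<sigma>"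
    by (intro MR_space_add[OF MR_space_mult]) auto
  then show ?case using insert by simp
qed

lemma lin_comb_in_MR_space:
  "lin_comb n a (\<lambda>i. unit_vec (r i)) \<in> MR_space m \<sigma>"
  unfolding lin_comb_def by (intro MR_space_sum unit_vec_in_MR_space) simp

section \<open>The unit vectors form a monotone basis\<close>

text \<open>
  Why truncation does not increase the norm: let \<open>t\<close> be the last set of the list that meets
  \<open>{..<n}\<close>. Replace \<open>t - {..<n}\<close> by equally many indices beyond the place from which on
  \<open>norm (w k) < e / card t\<close>. The size, hence the coding, is unchanged, the Schreier condition survives
  because the minimum has not decreased, and the new indices change the value at \<open>w\<close> by at most \<open>e\<close>.
\<close>

lemma norm_truncation_functional_le:
  fixes w :: "nat \<Rightarrow> 'a::real_normed_field"
  assumes w: "w \<in> MR_space m \<sigma>" "w \<longlonglongrightarrow> 0" and e: "0 < e" and "ss \<in> MR_lists m \<sigma>"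
  shows "norm (list_functional ss (\<lambda>k. if k < n then w k else 0)) \<le> MR_norm m \<sigma> w + e"
  using assms(4)
proof (induction ss rule: rev_induct)
  case Nil
  then show ?case by (simp add: MR_lists_def)
next
  case (snoc t ss)
  let ?w = "\<lambda>k. if k < n then w k else 0"
  note t = MR_lists_snocD[OF snoc.prems]
  show ?case
  proof (cases "\<exists>x\<in>t. x < n")
    case False
    then have 0: "(\<Sum>j\<in>t. ?w j) = 0" by (intro sum.neutral) auto
    show ?thesis
    proof (cases "ss = []")
      case True
      then show ?thesis using 0 e MR_norm_nonneg[OF w(1)] by (simp add: list_functional_def)
    next
      case False
      then show ?thesis using 0 snoc MR_lists_butlast by simp
    qed
  next
    case True
    then obtain x0 where x0: "x0 \<in> t" "x0 < n" by auto
    define p where "p = card t"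
    have p: "0 < p" using t by (simp add: p_def)
    have "\<forall>\<^sub>F k in sequentially. norm (w k) < e / p"
      using w(2) e p by (auto dest!: tendstoD[of _ _ _ "e / p"])
    then obtain b where b: "\<And>k. b \<le> k \<Longrightarrow> norm (w k) < e / p"
      by (auto simp: eventually_sequentially)
    define t0 where "t0 = t \<inter> {..<n}"
    obtain f where f: "finite f" "card f = card (t - t0)" "\<And>x. x \<in> f \<Longrightarrow> max b n < x"
      using finite_subset_beyond[of UNIV "card (t - t0)" "max b n"] by auto
    have fin: "finite t0" "t0 \<subseteq> t" using t by (auto simp: t0_def)
    have disj: "t0 \<inter> f = {}" using f(3) by (force simp: t0_def)
    have card: "card (t0 \<union> f) = p"
      using fin f t disj by (simp add: card_Un_disjoint card_Diff_subset p_def card_mono)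
    have "ss @ [t0 \<union> f] \<in> MR_lists m \<sigma>"
    proof (cases "ss = []")
      case True
      have "Min t \<le> Min (t0 \<union> f)"
      proof (rule Min.boundedI)
        show "finite (t0 \<union> f)" "t0 \<union> f \<noteq> {}" using fin f x0 by (auto simp: t0_def)
        fix x assume "x \<in> t0 \<union> f"
        moreover have "Min t \<le> x0" using t x0 by simp
        ultimately show "Min t \<le> x"
          using Min_le[OF t(1), of x] x0 f(3)[of x] by (auto simp: t0_def)
      qed
      then show ?thesis
        using snoc.prems True card fin f by (auto simp: MR_lists_singleton schreier_def p_def)
    next
      case False
      have "x < y" if xy: "x \<in> \<Union>(set ss)" "y \<in> t0 \<union> f" for x y
        using xy(2) t(3)[OF xy(1), of y] t(3)[OF xy(1) x0(1)] x0(2) f(3)[of y] fin(2) by auto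
      moreover have "card (t0 \<union> f) = \<sigma> (\<Union>(set ss))" using t(4)[OF False] card p_def by simp
      ultimately show ?thesis
        using fin(1) f(1) by (intro MR_lists_snocI MR_lists_butlast[OF snoc.prems False]) simp_all
    qed
    then have "norm (list_functional (ss @ [t0 \<union> f]) w) \<le> MR_norm m \<sigma> w"
      by (rule MR_norm_ge[OF w(1)])
    moreover have "list_functional (ss @ [t0 \<union> f]) w =
        list_functional (ss @ [t]) ?w + (1 / sqrt p) *\<^sub>R (\<Sum>j\<in>f. w j)"
    proof -
      have "list_functional ss ?w = list_functional ss w"
        using t(3) x0 by (intro list_functional_cong) force
      moreover have "(\<Sum>j\<in>t. ?w j) = (\<Sum>j\<in>t0. w j)"
        unfolding t0_def using t by (simp add: sum.inter_restrict cong: if_cong)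
      ultimately show ?thesis
        using fin f disj by (simp add: card sum.union_disjoint scaleR_add_right flip: p_def)
    qed
    moreover have "norm ((1 / sqrt p) *\<^sub>R (\<Sum>j\<in>f. w j)) \<le> e"
    proof -
      have "norm (\<Sum>j\<in>f. w j) \<le> card f * (e / p)"
        using b f(3) by (intro order_trans[OF norm_sum] sum_bounded_above) (force intro: less_imp_le)
      also have "\<dots> \<le> p * (e / p)"
        using f(2) t(1) e by (intro mult_right_mono) (auto simp: p_def intro: card_mono)
      finally have "norm (\<Sum>j\<in>f. w j) \<le> e" using p by simp
      moreover have "1 \<le> sqrt p" using p by simp
      ultimately have "norm (\<Sum>j\<in>f. w j) \<le> e * sqrt p"
        using e by (meson mult_left_mono less_imp_le order_trans mult_le_cancel_left1 not_le)
      then show ?thesis using p by (simp add: field_simps)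
    qed
    ultimately show ?thesis
      using norm_triangle_ineq4[of "list_functional (ss @ [t0 \<union> f]) w" "(1 / sqrt p) *\<^sub>R (\<Sum>j\<in>f. w j)"]
      by simp
  qed
qed

lemma MR_norm_truncation_le:
  fixes w :: "nat \<Rightarrow> 'a::real_normed_field"
  assumes "w \<in> MR_space m \<sigma>" "w \<longlonglongrightarrow> 0"
  shows "MR_norm m \<sigma> (\<lambda>k. if k < n then w k else 0) \<le> MR_norm m \<sigma> w"
proof (rule MR_norm_le)
  show "norm (list_functional ss (\<lambda>k. if k < n then w k else 0)) \<le> MR_norm m \<sigma> w"
    if "ss \<in> MR_lists m \<sigma>" for ss
    by (rule field_le_epsilon) (rule norm_truncation_functional_le[OF assms _ that])
  show "norm (if k < n then w k else 0) \<le> MR_norm m \<sigma> w" for k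
    using MR_norm_ge(2)[OF assms(1)] MR_norm_nonneg[OF assms(1)] by simp
qed

text \<open>
  The coefficients of \<open>v\<close> can only be its coordinates. They work because \<open>v\<close> is within \<open>e / 2\<close> of a
  finitely supported vector, and the truncations at large \<open>n\<close> fix that vector and do not increase the norm of the
  difference.
\<close>

lemma basic_sequence_unit_vec:
  "basic_sequence (MR_space m \<sigma>) (MR_norm m \<sigma>) (unit_vec :: nat \<Rightarrow> nat \<Rightarrow> 'a::real_normed_field)"
  unfolding basic_sequence_def
proof (intro conjI allI ballI unit_vec_in_MR_space)
  let ?V = "MR_space m \<sigma> :: (nat \<Rightarrow> 'a) set" and ?N = "MR_norm m \<sigma> :: (nat \<Rightarrow> 'a) \<Rightarrow> real"
  let ?P = "\<lambda>n a. lin_comb n a (unit_vec :: nat \<Rightarrow> nat \<Rightarrow> 'a)"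
  fix v assume "v \<in> closed_span ?V ?N unit_vec"
  then have v: "v \<in> ?V" and approx: "\<And>e. 0 < e \<Longrightarrow> \<exists>n a. ?N (\<lambda>k. v k - ?P n a k) < e"
    by (auto simp: closed_span_def)
  have diff: "(\<lambda>k. v k - ?P n a k) \<in> ?V" for n a
    using v lin_comb_in_MR_space[of n a id] by (intro MR_space_diff) simp_all
  have v0: "v \<longlonglongrightarrow> 0"
  proof (rule LIMSEQ_I)
    fix e :: real assume "0 < e"
    then obtain n a where na: "?N (\<lambda>k. v k - ?P n a k) < e" using approx by blast
    have "norm (v k) < e" if "n \<le> k" for k
      using MR_norm_ge(2)[OF diff, of k n a] na that by (simp add: lin_comb_unit_vec)
    then show "\<exists>no. \<forall>k\<ge>no. norm (v k - 0) < e" by auto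
  qed
  show "\<exists>!a. (\<lambda>n. ?N (\<lambda>k. v k - ?P n a k)) \<longlonglongrightarrow> 0"
  proof (rule ex1I)
    show "(\<lambda>n. ?N (\<lambda>k. v k - ?P n v k)) \<longlonglongrightarrow> 0"
    proof (rule LIMSEQ_I)
      fix e :: real assume "0 < e"
      then obtain n0 a where na: "?N (\<lambda>k. v k - ?P n0 a k) < e / 2"
        using approx[of "e / 2"] by auto
      let ?w = "\<lambda>k. v k - ?P n0 a k"
      have "?P n0 a \<longlonglongrightarrow> 0"
        by (rule tendsto_eventually, rule eventually_mono[OF eventually_ge_at_top[of n0]])
           (simp add: lin_comb_unit_vec)
      from tendsto_diff[OF v0 this] have w0: "?w \<longlonglongrightarrow> 0" by simp
      have "norm (?N (\<lambda>k. v k - ?P n v k) - 0) < e" if n: "n0 \<le> n" for n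
      proof -
        let ?Q = "\<lambda>k. if k < n then ?w k else 0"
        have Q: "?Q = ?P n ?w" by (auto simp: lin_comb_unit_vec fun_eq_iff)
        have "(\<lambda>k. v k - ?P n v k) = (\<lambda>k. ?w k - ?Q k)"
          using n by (auto simp: lin_comb_unit_vec fun_eq_iff)
        then have "?N (\<lambda>k. v k - ?P n v k) = ?N (\<lambda>k. ?w k - ?Q k)" by simp
        also have "\<dots> \<le> ?N ?w + ?N ?Q"
          using lin_comb_in_MR_space[of n ?w id] by (intro MR_norm_diff diff) (simp add: Q)
        also have "\<dots> \<le> ?N ?w + ?N ?w"
          by (intro add_left_mono MR_norm_truncation_le diff w0)
        finally show ?thesis using na MR_norm_nonneg[OF diff, of n v] by simp
      qed
      then show "\<exists>no. \<forall>n\<ge>no. norm (?N (\<lambda>k. v k - ?P n v k) - 0) < e" by blast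
    qed
  next
    fix a assume a: "(\<lambda>n. ?N (\<lambda>k. v k - ?P n a k)) \<longlonglongrightarrow> 0"
    show "a = v"
    proof
      fix k
      have "norm (v k - a k) \<le> ?N (\<lambda>k. v k - ?P n a k)" if "k < n" for n
        using MR_norm_ge(2)[OF diff, of k n a] that by (simp add: lin_comb_unit_vec)
      then have "\<forall>\<^sub>F n in sequentially. norm (v k - a k) \<le> ?N (\<lambda>k. v k - ?P n a k)"
        unfolding eventually_sequentially by (intro exI[of _ "Suc k"]) auto
      from tendsto_lowerbound[OF a this] show "a k = v k" by simp
    qed
  qed
qed

section \<open>Weak convergence\<close>

text \<open>
  A set of size \<open>p\<close> contributes at most \<open>min (card A) p / sqrt p\<close>. The bound \<open>card A / sqrt p\<close> is
  used for the large sizes, where the convergent series of \<open>1 / sqrt p\<close> has a tail below \<open>e\<close>, and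
  \<open>sqrt p\<close> for the finitely many other sizes, which add up to a constant.
\<close>

lemma MR_norm_le_epsilon_card:
  assumes "0 < (e :: real)"
  shows "\<exists>B. \<forall>A. \<forall>y :: nat \<Rightarrow> 'a::real_normed_field. finite A \<longrightarrow> (\<forall>k. norm (y k) \<le> 1) \<longrightarrow>
    (\<forall>k. k \<notin> A \<longrightarrow> y k = 0) \<longrightarrow> MR_norm m \<sigma> y \<le> e * card A + B"
proof -
  have inj: "inj m" using m_mono by (rule strict_mono_imp_inj_on)
  have le2: "(\<Sum>k\<in>K. 1 / sqrt (real (m k))) \<le> 2" if "finite K" for K
    using sum_inverse_sqrt_le_2[of "m ` K"] that inj_on_subset[OF inj, of K]
    by (simp add: sum.reindex image_mono)
  have "summable (\<lambda>k. 1 / sqrt (real (m k)))"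
    by (rule summableI_nonneg_bounded[where x = 2]) (auto intro: le2)
  then obtain L where L: "\<And>n. norm (\<Sum>k\<in>{L..<n}. 1 / sqrt (real (m k))) < e"
    using assms unfolding summable_Cauchy by blast
  have tail: "(\<Sum>p\<in>P. 1 / sqrt (real p)) \<le> e" if P: "finite P" "P \<subseteq> m ` {L..}" for P
  proof -
    obtain K where K: "P = m ` K" "K \<subseteq> {L..}" using P(2) by (auto simp: subset_image_iff)
    then have "finite K" using P(1) inj by (auto dest: finite_imageD inj_on_subset)
    then obtain n where "K \<subseteq> {..<n}" by (auto simp: finite_nat_iff_bounded)
    then have "K \<subseteq> {L..<n}" using K(2) by auto
    then have "(\<Sum>k\<in>K. 1 / sqrt (real (m k))) \<le> (\<Sum>k\<in>{L..<n}. 1 / sqrt (real (m k)))"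
      by (intro sum_mono2) auto
    also have "\<dots> \<le> e" using L[of n] by simp
    finally show ?thesis using K inj by (simp add: sum.reindex inj_on_subset)
  qed
  \<comment> \<open>the sizes below \<open>m L\<close>, and 1 for the supremum norm\<close>
  define B where "B = max 1 (\<Sum>p\<in>m ` {..<L}. sqrt (real p))"
  have "MR_norm m \<sigma> y \<le> e * card A + B"
    if A: "finite A" and y: "\<And>k. norm (y k) \<le> 1" "\<And>k. k \<notin> A \<Longrightarrow> y k = 0"
    for A and y :: "nat \<Rightarrow> 'a"
  proof (rule MR_norm_le)
    show "norm (y n) \<le> e * card A + B" for n
    proof -
      have "0 \<le> e * card A" "1 \<le> B" using assms by (simp_all add: B_def)
      then show ?thesis using y(1)[of n] by linarith
    qed
    fix ss assume ss: "ss \<in> MR_lists m \<sigma>"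
    let ?c = "\<lambda>i. card (ss ! i)"
    let ?P = "?c ` {..<length ss}"
    have "norm (list_functional ss y) \<le> (\<Sum>i<length ss. (\<Sum>j\<in>ss ! i. norm (y j)) / sqrt (real (?c i)))"
      by (rule norm_list_functional_le)
    also have "\<dots> \<le> (\<Sum>i<length ss. min (real (card A)) (real (?c i)) / sqrt (real (?c i)))"
    proof (intro sum_mono divide_right_mono)
      fix i assume "i \<in> {..<length ss}"
      then have fin: "finite (ss ! i)" using MR_lists_nth ss by auto
      have "(\<Sum>j\<in>ss ! i. norm (y j)) = (\<Sum>j\<in>ss ! i \<inter> A. norm (y j))"
        using fin y by (intro sum.mono_neutral_right) auto
      also have "\<dots> \<le> real (card (ss ! i \<inter> A)) * 1"
        by (rule sum_bounded_above) (use y in auto)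
      also have "\<dots> \<le> min (real (card A)) (real (?c i))"
        using A fin by (simp add: card_mono)
      finally show "(\<Sum>j\<in>ss ! i. norm (y j)) \<le> min (real (card A)) (real (?c i))" .
    qed simp
    also have "\<dots> = (\<Sum>p\<in>?P. min (real (card A)) (real p) / sqrt (real p))"
      by (simp add: sum.reindex[OF card_nth_inj_on[OF ss]])
    also have "\<dots> = (\<Sum>p\<in>?P \<inter> m ` {L..}. min (real (card A)) (real p) / sqrt (real p)) +
        (\<Sum>p\<in>?P - m ` {L..}. min (real (card A)) (real p) / sqrt (real p))"
      by (subst sum.Int_Diff[of _ _ "m ` {L..}"]) auto
    also have "\<dots> \<le> (\<Sum>p\<in>?P \<inter> m ` {L..}. card A * (1 / sqrt (real p))) +
        (\<Sum>p\<in>?P - m ` {L..}. sqrt (real p))"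
    proof (intro add_mono sum_mono)
      show "min (real (card A)) (real p) / sqrt (real p) \<le> card A * (1 / sqrt (real p))" for p
        by (simp add: divide_right_mono)
      have "min (real (card A)) (real p) / sqrt (real p) \<le> real p / sqrt (real p)" for p
        by (rule divide_right_mono) auto
      then show "min (real (card A)) (real p) / sqrt (real p) \<le> sqrt (real p)" for p
        by (simp add: real_div_sqrt)
    qed
    also have "\<dots> \<le> card A * e + (\<Sum>p\<in>m ` {..<L}. sqrt (real p))"
    proof (intro add_mono)
      show "(\<Sum>p\<in>?P \<inter> m ` {L..}. card A * (1 / sqrt (real p))) \<le> card A * e"
        unfolding sum_distrib_left[symmetric] by (intro mult_left_mono tail) auto
      have "?P - m ` {L..} \<subseteq> m ` {..<L}"
        using MR_lists_nth(2)[OF ss] by (force simp: not_le)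
      then show "(\<Sum>p\<in>?P - m ` {L..}. sqrt (real p)) \<le> (\<Sum>p\<in>m ` {..<L}. sqrt (real p))"
        by (intro sum_mono2) auto
    qed
    finally show "norm (list_functional ss y) \<le> e * card A + B"
      by (simp add: B_def mult.commute)
  qed
  then show ?thesis by blast
qed

lemma dual_space_sum:
  fixes f :: "(nat \<Rightarrow> 'a) \<Rightarrow> 'a::real_normed_field"
  assumes f: "f \<in> dual_space (MR_space m \<sigma>) (MR_norm m \<sigma>)"
    and "finite A" "\<And>j. j \<in> A \<Longrightarrow> x j \<in> MR_space m \<sigma>"
  shows "f (\<lambda>k. \<Sum>j\<in>A. b j * x j k) = (\<Sum>j\<in>A. b j * f (x j))"
  using assms(2,3)
proof (induction A rule: finite_induct)
  case empty
  have "f (\<lambda>k. 0 * unit_vec 0 k) = 0 * f (unit_vec 0)"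
    by (rule dual_space_mult[OF f unit_vec_in_MR_space])
  then show ?case by simp
next
  case (insert j A)
  have "f (\<lambda>k. b j * x j k + (\<Sum>j\<in>A. b j * x j k)) =
      f (\<lambda>k. b j * x j k) + f (\<lambda>k. \<Sum>j\<in>A. b j * x j k)"
    using insert by (intro dual_space_add[OF f] MR_space_mult MR_space_sum) auto
  moreover have "f (\<lambda>k. b j * x j k) = b j * f (x j)"
    using insert by (intro dual_space_mult[OF f]) simp
  ultimately show ?case using insert by simp
qed

text \<open>
  If \<open>norm (f u\<^sub>j) \<ge> c > 0\<close> for all \<open>j\<close> in an infinite set, then the vector
  \<open>\<Sum>j\<in>A. (c / f u\<^sub>j) u\<^sub>j\<close> has coordinates of modulus at most 1 and \<open>f\<close> maps it to \<open>c * card A\<close>, for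
  every finite part \<open>A\<close> of that set. This contradicts the sublinear growth of the norm.
\<close>

lemma weakly_null_unit_vec:
  "weakly_null (MR_space m \<sigma>) (MR_norm m \<sigma>) (unit_vec :: nat \<Rightarrow> nat \<Rightarrow> 'a::real_normed_field)"
  unfolding weakly_null_def
proof (intro conjI allI ballI unit_vec_in_MR_space)
  fix f :: "(nat \<Rightarrow> 'a) \<Rightarrow> 'a" assume f: "f \<in> dual_space (MR_space m \<sigma>) (MR_norm m \<sigma>)"
  then obtain K0 where K0: "\<And>v. v \<in> MR_space m \<sigma> \<Longrightarrow> norm (f v) \<le> K0 * MR_norm m \<sigma> v"
    unfolding dual_space_def by blast
  define K where "K = max K0 1"
  have K: "norm (f v) \<le> K * MR_norm m \<sigma> v" if "v \<in> MR_space m \<sigma>" for v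
    using mult_right_mono[OF max.cobounded1[of K0 1] MR_norm_nonneg[OF that]] K0[OF that]
    unfolding K_def by linarith
  have "1 \<le> K" by (simp add: K_def)
  show "(\<lambda>n. f (unit_vec n)) \<longlonglongrightarrow> 0"
  proof (rule ccontr)
    assume "\<not> (\<lambda>n. f (unit_vec n)) \<longlonglongrightarrow> 0"
    then obtain c where c: "0 < c" "\<And>no. \<exists>n\<ge>no. c \<le> norm (f (unit_vec n))"
      unfolding LIMSEQ_iff by (auto simp: not_less)
    define I where "I = {n. c \<le> norm (f (unit_vec n))}"
    have "infinite I" using c(2) by (auto simp: I_def infinite_nat_iff_unbounded_le)
    define e where "e = c / (2 * K)"
    have "0 < e" using c \<open>1 \<le> K\<close> by (simp add: e_def)
    from MR_norm_le_epsilon_card[OF this, where 'a = 'a]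
    obtain B where B: "\<And>A (y :: nat \<Rightarrow> 'a). finite A \<Longrightarrow> (\<And>k. norm (y k) \<le> 1) \<Longrightarrow>
        (\<And>k. k \<notin> A \<Longrightarrow> y k = 0) \<Longrightarrow> MR_norm m \<sigma> y \<le> e * card A + B"
      by blast
    obtain N :: nat where N: "2 * K * B / c < N" using reals_Archimedean2 by blast
    obtain A where A: "finite A" "card A = N" "A \<subseteq> I"
      using infinite_arbitrarily_large[OF \<open>infinite I\<close>] by metis
    define b where "b j = of_real c / f (unit_vec j)" for j
    let ?y = "\<lambda>k. \<Sum>j\<in>A. b j * unit_vec j k"
    have y: "?y k = (if k \<in> A then b k else 0)" for k
      using A by (simp add: unit_vec_def if_distrib[of "times _"] cong: if_cong)
    have nz: "f (unit_vec j) \<noteq> 0" "c \<le> norm (f (unit_vec j))" if "j \<in> A" for j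
      using that A c by (auto simp: I_def)
    have "f ?y = (\<Sum>j\<in>A. b j * f (unit_vec j))"
      by (rule dual_space_sum[OF f A(1) unit_vec_in_MR_space])
    also have "\<dots> = (\<Sum>j\<in>A. of_real c)"
      using nz by (intro sum.cong) (auto simp: b_def)
    finally have "N * c = norm (f ?y)"
      using A c by (simp add: norm_mult)
    also have "\<dots> \<le> K * MR_norm m \<sigma> ?y"
      using A by (intro K MR_space_sum unit_vec_in_MR_space)
    also have "\<dots> \<le> K * (e * card A + B)"
    proof (intro mult_left_mono B A(1))
      show "norm (?y k) \<le> 1" for k
        unfolding y using nz[of k] c by (auto simp: b_def norm_divide divide_le_eq)
    qed (use y \<open>1 \<le> K\<close> in auto)
    also have "\<dots> = N * c / 2 + K * B" using \<open>1 \<le> K\<close> A by (simp add: e_def field_simps)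
    finally show False using N c by (simp add: field_simps)
  qed
qed

section \<open>Decoding the sets of a list\<close>

text \<open>
  By injectivity of \<open>\<sigma>\<close>, the sets before position \<open>i\<close> in \<open>ss\<close> and before \<open>l\<close> in \<open>ts\<close> have the same
  union \<open>V\<close>, and those before \<open>i'\<close> and \<open>l'\<close> the same union \<open>W\<close>. Both \<open>ss ! i\<close> and \<open>ts ! l\<close> consist
  of the first elements of \<open>W - V\<close>, and they have the same size. Position 0 is excluded since the
  size of the first set encodes nothing, and the later match \<open>i', l'\<close> is needed to know \<open>W\<close>.
\<close>

lemma matched_sets_eq:
  assumes ss: "ss \<in> MR_lists m \<sigma>" and ts: "ts \<in> MR_lists m \<sigma>"
    and i: "0 < i" "i < i'" "i' < length ss" and l: "0 < l" "l < l'" "l' < length ts"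
    and eq: "card (ss ! i) = card (ts ! l)" and eq': "card (ss ! i') = card (ts ! l')"
  shows "ss ! i = ts ! l"
proof -
  have fin: "finite (\<Union>(set (take h rs)))" if "rs \<in> MR_lists m \<sigma>" for h rs
    using that by (auto simp: MR_lists_def dest: in_set_takeD)
  have V: "\<Union>(set (take i ss)) = \<Union>(set (take l ts))"
    using MR_lists_card_eq[OF ss, of i] MR_lists_card_eq[OF ts, of l] i l eq fin ss ts
    by (intro inj_onD[OF \<sigma>_inj]) auto
  have W: "\<Union>(set (take i' ss)) = \<Union>(set (take l' ts))"
    using MR_lists_card_eq[OF ss, of i'] MR_lists_card_eq[OF ts, of l'] i l eq' fin ss ts
    by (intro inj_onD[OF \<sigma>_inj]) auto
  have sub: "rs ! h \<subseteq> \<Union>(set (take h' rs)) - \<Union>(set (take h rs))"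
    if rs: "rs \<in> MR_lists m \<sigma>" "h < h'" "h' < length rs" for rs h h'
  proof
    fix x assume x: "x \<in> rs ! h"
    have "x \<notin> rs ! g" if "g < h" for g
      using MR_lists_less[OF rs(1) that, of x x] x rs by auto
    then show "x \<in> \<Union>(set (take h' rs)) - \<Union>(set (take h rs))"
      using x rs unfolding Diff_iff mem_Union_take by force
  qed
  have seg: "x \<in> rs ! h"
    if rs: "rs \<in> MR_lists m \<sigma>" "h < h'" "h' < length rs"
      "x \<in> \<Union>(set (take h' rs)) - \<Union>(set (take h rs))" "y \<in> rs ! h" "x < y" for rs h h' x y
  proof -
    obtain g where g: "g < h'" "x \<in> rs ! g" "\<not> g < h"
      using rs(4) unfolding Diff_iff mem_Union_take by blast
    have "\<not> h < g"
    proof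
      assume "h < g"
      then have "y < x" using MR_lists_less[OF rs(1)] g rs(3,5) less_trans by blast
      then show False using rs(6) by simp
    qed
    then show ?thesis using g by (cases g h rule: linorder_cases) auto
  qed
  show ?thesis
  proof (rule initial_segments_eq[where D = "\<Union>(set (take i' ss)) - \<Union>(set (take i ss))"])
    show "ss ! i \<subseteq> \<Union>(set (take i' ss)) - \<Union>(set (take i ss))" using sub[OF ss i(2,3)] .
    show "ts ! l \<subseteq> \<Union>(set (take i' ss)) - \<Union>(set (take i ss))"
      using sub[OF ts l(2,3)] unfolding V W .
    show "x \<in> ss ! i" if "x \<in> \<Union>(set (take i' ss)) - \<Union>(set (take i ss))" "y \<in> ss ! i" "x < y" for x y
      using seg[OF ss i(2,3) that] .
    show "x \<in> ts ! l" if "x \<in> \<Union>(set (take i' ss)) - \<Union>(set (take i ss))" "y \<in> ts ! l" "x < y" for x y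
      using seg[OF ts l(2,3) that(1)[unfolded V W] that(2,3)] .
  qed (use MR_lists_nth(1) ss ts i l eq in auto)
qed

section \<open>No subsequence is RUD\<close>

text \<open>
  The vector whose norm is large while its sign changes are bounded on average. It is real valued, and
  is embedded into the scalar field where it is used.
\<close>

definition block_vector :: "nat set list \<Rightarrow> nat \<Rightarrow> real" where
  "block_vector ss k = (\<Sum>i<length ss. if k \<in> ss ! i then 1 / sqrt (real (card (ss ! i))) else 0)"

lemma block_vector_nonneg: "0 \<le> block_vector ss k"
  unfolding block_vector_def by (rule sum_nonneg) simp

lemma block_vector_le_2: "ss \<in> MR_lists m \<sigma> \<Longrightarrow> block_vector ss k \<le> 2"
  unfolding block_vector_def
  by (rule order_trans[OF sum_mono sum_list_inverse_sqrt_le_2]) auto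

lemma block_vector_eq_0: "k \<notin> \<Union>(set ss) \<Longrightarrow> block_vector ss k = 0"
  unfolding block_vector_def by (rule sum.neutral) auto

lemma list_functional_block_vector_ge:
  assumes ss: "ss \<in> MR_lists m \<sigma>"
  shows "real (length ss) \<le>
    norm (list_functional ss (\<lambda>k. of_real (block_vector ss k) :: 'a::real_normed_field))"
proof -
  let ?p = "\<lambda>i. real (card (ss ! i))"
  have "real (length ss) = (\<Sum>i<length ss. 1)" by simp
  also have "\<dots> \<le> (\<Sum>i<length ss. (1 / sqrt (?p i)) * (\<Sum>j\<in>ss ! i. block_vector ss j))"
  proof (rule sum_mono)
    fix i assume "i \<in> {..<length ss}"
    then have i: "i < length ss" by simp
    have "?p i * (1 / sqrt (?p i)) \<le> (\<Sum>j\<in>ss ! i. block_vector ss j)"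
    proof (rule sum_bounded_below)
      fix j assume "j \<in> ss ! i"
      then show "1 / sqrt (?p i) \<le> block_vector ss j"
        unfolding block_vector_def
        using i member_le_sum[of i "{..<length ss}" "\<lambda>i. if j \<in> ss ! i then 1 / sqrt (?p i) else 0"]
        by simp
    qed
    then have "(1 / sqrt (?p i)) * (?p i * (1 / sqrt (?p i))) \<le>
        (1 / sqrt (?p i)) * (\<Sum>j\<in>ss ! i. block_vector ss j)"
      by (rule mult_left_mono) simp
    then show "1 \<le> (1 / sqrt (?p i)) * (\<Sum>j\<in>ss ! i. block_vector ss j)"
      using MR_lists_nth(3)[OF ss i] by simp
  qed
  also have "\<dots> = norm (of_real (\<Sum>i<length ss. (1 / sqrt (?p i)) * (\<Sum>j\<in>ss ! i. block_vector ss j)) :: 'a)"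
    by (simp add: block_vector_nonneg sum_nonneg del: of_real_sum of_real_mult of_real_divide)
  also have "of_real (\<Sum>i<length ss. (1 / sqrt (?p i)) * (\<Sum>j\<in>ss ! i. block_vector ss j)) =
      list_functional ss (\<lambda>k. of_real (block_vector ss k) :: 'a)"
    by (simp add: list_functional_nth scaleR_conv_of_real)
  finally show ?thesis .
qed

text \<open>
  The sum over \<open>s \<inter> t\<close> has at most \<open>min (card s) (card t)\<close> terms.
\<close>

lemma norm_block_pairing_le:
  fixes E :: "nat \<Rightarrow> 'a::real_normed_field"
  assumes E: "\<And>k. norm (E k) \<le> 1" and s: "finite s" "0 < card s" and t: "finite t" "0 < card t"
  shows "norm (\<Sum>j\<in>s \<inter> t. E j) / (sqrt (card s) * sqrt (card t))
    \<le> (if card s = card t then 1 else closeness (card s) (card t))"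
proof -
  have "norm (\<Sum>j\<in>s \<inter> t. E j) \<le> real (card (s \<inter> t)) * 1"
    by (rule order_trans[OF norm_sum]) (rule sum_bounded_above, rule E)
  also have "\<dots> \<le> min (real (card s)) (real (card t))"
    using s t by (simp add: card_mono)
  finally have "norm (\<Sum>j\<in>s \<inter> t. E j) / (sqrt (card s) * sqrt (card t))
      \<le> min (real (card s)) (real (card t)) / (sqrt (card s) * sqrt (card t))"
    by (rule divide_right_mono) simp
  also have "\<dots> = sqrt (min (real (card s) / real (card t)) (real (card t) / real (card s)))"
  proof -
    have *: "min x y / (sqrt x * sqrt y) = sqrt (min (x / y) (y / x))" if "0 < x" "x \<le> y" for x y :: real
    proof -
      have "x / y \<le> 1" "1 \<le> y / x" using that by auto
      then have "min (x / y) (y / x) = x / y" by linarith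
      moreover have "x / (sqrt x * sqrt y) = sqrt x / sqrt y"
        using that by (simp add: real_div_sqrt flip: divide_divide_eq_left)
      ultimately show ?thesis using that by (simp add: real_sqrt_divide)
    qed
    show ?thesis
      using *[of "card s" "card t"] *[of "card t" "card s"] s t
      by (cases "card s \<le> card t") (auto simp: min.commute mult.commute)
  qed
  finally show ?thesis using s t by (auto simp: closeness_def split: if_splits)
qed

text \<open>
  The value of a functional given by \<open>ts\<close> is a double sum over the pairs \<open>ss ! i, ts ! l\<close>. Pairs of
  different sizes add up to at most 1. A size occurs at most once in each list, so the pairs of equal
  size form a partial matching; those with \<open>i = 0\<close>, with \<open>l = 0\<close> and with the last possible \<open>i\<close> cost 1
  each, and in the others the two sets coincide.
\<close>

lemma MR_norm_signed_block_vector_le: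
  fixes E :: "nat \<Rightarrow> 'a::real_normed_field"
  assumes ss: "ss \<in> MR_lists m \<sigma>" and E: "\<And>k. norm (E k) \<le> 1"
  shows "MR_norm m \<sigma> (\<lambda>k. E k * of_real (block_vector ss k))
    \<le> 4 + (\<Sum>i<length ss. norm (\<Sum>j\<in>ss ! i. E j) / card (ss ! i))"
proof (rule MR_norm_le)
  let ?p = "\<lambda>i. card (ss ! i)"
  define D where "D i = norm (\<Sum>j\<in>ss ! i. E j) / ?p i" for i
  have D: "0 \<le> D i" for i by (simp add: D_def)
  have D_sum: "0 \<le> (\<Sum>i<length ss. D i)" by (simp add: D sum_nonneg)
  show "norm (E k * of_real (block_vector ss k)) \<le> 4 + (\<Sum>i<length ss. norm (\<Sum>j\<in>ss ! i. E j) / ?p i)" for k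
  proof -
    have "norm (E k * of_real (block_vector ss k)) \<le> 1 * block_vector ss k"
      unfolding norm_mult using E by (intro mult_mono) (auto simp: block_vector_nonneg)
    then show ?thesis using block_vector_le_2[OF ss, of k] D_sum by (simp add: D_def)
  qed
  fix ts assume ts: "ts \<in> MR_lists m \<sigma>"
  let ?q = "\<lambda>l. card (ts ! l)"
  let ?c = "\<lambda>i l. norm (\<Sum>j\<in>ss ! i \<inter> ts ! l. E j) / (sqrt (?p i) * sqrt (?q l))"
  define last_match where "last_match = Max {i. i < length ss \<and> (\<exists>l<length ts. ?p i = ?q l)}"
  \<comment> \<open>The cost of a matched pair is charged to \<open>i\<close> by \<open>F\<close> and, for \<open>l = 0\<close>, to \<open>l\<close> by \<open>G\<close>.\<close>
  define F where "F i = D i + (if i = 0 then 1 else 0) + (if i = last_match then 1 else 0)" for i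
  define G where "G l = (if l = (0::nat) then 1 else 0 :: real)" for l
  have FG: "0 \<le> F i" "0 \<le> G l" for i l using D by (simp_all add: F_def G_def)
  have c_le: "?c i l \<le> closeness (?p i) (?q l) + (if ?p i = ?q l then F i else 0) +
      (if ?q l = ?p i then G l else 0)" if i: "i < length ss" and l: "l < length ts" for i l
  proof -
    have pos: "0 < ?p i" "0 < ?q l" and fin: "finite (ss ! i)" "finite (ts ! l)"
      using MR_lists_nth ss ts i l by auto
    note le = norm_block_pairing_le[where E = E, OF E fin(1) pos(1) fin(2) pos(2)]
    show ?thesis
    proof (cases "?p i = ?q l \<and> i \<noteq> 0 \<and> l \<noteq> 0 \<and> i \<noteq> last_match")
      case False
      have "1 \<le> F i + G l" if "?p i = ?q l"
        using that False D[of i] by (auto simp: F_def G_def)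
      then show ?thesis using le closeness_nonneg[of "?p i" "?q l"] by (auto split: if_splits)
    next
      case True
      let ?I = "{i. i < length ss \<and> (\<exists>l<length ts. ?p i = ?q l)}"
      have I: "finite ?I" "i \<in> ?I" using True i l by auto
      then have "?I \<noteq> {}" by blast
      then have "last_match \<in> ?I" "i \<le> last_match"
        unfolding last_match_def using Max_in[OF I(1)] Max_ge[OF I] by auto
      then obtain l' where l': "last_match < length ss" "i < last_match" "l' < length ts"
          "?p last_match = ?q l'"
        using True by auto
      have "?q l < ?q l'" using MR_lists_card_less[OF ss, of i last_match] l' True by simp
      then have "l < l'"
        using MR_lists_card_less[OF ts, of l' l] l by (cases l l' rule: linorder_cases) auto
      then have "ss ! i = ts ! l"
        using True l' by (intro matched_sets_eq[OF ss ts, of i last_match l l']) auto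
      then have "?c i l = D i" using pos by (simp add: D_def)
      also have "\<dots> \<le> F i" by (simp add: F_def)
      finally show ?thesis using True FG(2)[of l] closeness_nonneg[of "?p i" "?q l"] by simp
    qed
  qed
  have "list_functional ts (\<lambda>k. E k * of_real (block_vector ss k)) =
      (\<Sum>l<length ts. \<Sum>i<length ss. (1 / (sqrt (?p i) * sqrt (?q l))) *\<^sub>R (\<Sum>j\<in>ss ! i \<inter> ts ! l. E j))"
    unfolding list_functional_nth
  proof (intro sum.cong refl)
    fix l assume "l \<in> {..<length ts}"
    then have fin: "finite (ts ! l)" using MR_lists_nth ts by auto
    have "(\<Sum>j\<in>ts ! l. E j * of_real (block_vector ss j)) =
        (\<Sum>j\<in>ts ! l. \<Sum>i<length ss. (1 / sqrt (?p i)) *\<^sub>R (if j \<in> ss ! i then E j else 0))"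
      unfolding block_vector_def of_real_sum sum_distrib_left
      by (intro sum.cong) (auto simp: scaleR_conv_of_real)
    also have "\<dots> = (\<Sum>i<length ss. (1 / sqrt (?p i)) *\<^sub>R (\<Sum>j\<in>ts ! l. if j \<in> ss ! i then E j else 0))"
      unfolding scaleR_sum_right by (rule sum.swap)
    also have "\<dots> = (\<Sum>i<length ss. (1 / sqrt (?p i)) *\<^sub>R (\<Sum>j\<in>ss ! i \<inter> ts ! l. E j))"
      by (simp only: Int_commute[of _ "ts ! l"] sum.inter_restrict[OF fin])
    finally show "(1 / sqrt (?q l)) *\<^sub>R (\<Sum>j\<in>ts ! l. E j * of_real (block_vector ss j)) =
        (\<Sum>i<length ss. (1 / (sqrt (?p i) * sqrt (?q l))) *\<^sub>R (\<Sum>j\<in>ss ! i \<inter> ts ! l. E j))"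
      by (simp add: scaleR_sum_right mult.commute)
  qed
  then have "norm (list_functional ts (\<lambda>k. E k * of_real (block_vector ss k))) \<le>
      (\<Sum>l<length ts. \<Sum>i<length ss. ?c i l)"
    by (auto intro!: sum_norm_le simp: abs_mult)
  also have "\<dots> \<le> (\<Sum>l<length ts. \<Sum>i<length ss. closeness (?p i) (?q l) +
      (if ?p i = ?q l then F i else 0) + (if ?q l = ?p i then G l else 0))"
    by (intro sum_mono c_le) auto
  also have "\<dots> = (\<Sum>i<length ss. \<Sum>l<length ts. closeness (?p i) (?q l)) +
      (\<Sum>i<length ss. \<Sum>l<length ts. if ?p i = ?q l then F i else 0) +
      (\<Sum>l<length ts. \<Sum>i<length ss. if ?q l = ?p i then G l else 0)"
    unfolding sum.distrib
    using sum.swap[of "\<lambda>l i. closeness (?p i) (?q l)" "{..<length ss}" "{..<length ts}"]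
      sum.swap[of "\<lambda>l i. if ?p i = ?q l then F i else 0" "{..<length ss}" "{..<length ts}"] by simp
  also have "\<dots> \<le> 1 + (\<Sum>i<length ss. F i) + (\<Sum>l<length ts. G l)"
  proof (intro add_mono sum_mono sum_matched_le card_nth_inj_on ss ts FG)
    have "(\<Sum>i<length ss. \<Sum>l<length ts. closeness (?p i) (?q l)) =
        (\<Sum>p\<in>?p ` {..<length ss}. \<Sum>q\<in>?q ` {..<length ts}. closeness p q)"
      by (simp add: sum.reindex card_nth_inj_on ss ts)
    also have "\<dots> \<le> 1"
      using MR_lists_nth(2)[OF ss] MR_lists_nth(2)[OF ts] by (intro sum_closeness_le_1) auto
    finally show "(\<Sum>i<length ss. \<Sum>l<length ts. closeness (?p i) (?q l)) \<le> 1" .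
  qed auto
  also have "\<dots> \<le> 1 + ((\<Sum>i<length ss. D i) + 1 + 1) + 1"
    unfolding F_def G_def sum.distrib by (intro add_mono) auto
  finally show "norm (list_functional ts (\<lambda>k. E k * of_real (block_vector ss k))) \<le>
      4 + (\<Sum>i<length ss. norm (\<Sum>j\<in>ss ! i. E j) / ?p i)"
    by (simp add: D_def)
qed

text \<open>
  Averaging the preceding bound: the mean of the modulus of a sum of \<open>p\<close> signs is at most \<open>sqrt p\<close>, so
  what remains is \<open>4 + \<Sum> 1 / sqrt p \<le> 6\<close>. The sets of the list lie in the range of \<open>r\<close> and are
  pulled back to sets of positions in the subsequence.
\<close>

lemma sign_average_block_vector_le:
  fixes r :: "nat \<Rightarrow> nat"
  assumes ss: "ss \<in> MR_lists m \<sigma>" and r: "inj r" and sub: "\<Union>(set ss) \<subseteq> r ` {..<N}"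
  shows "sign_average (MR_norm m \<sigma>) N
    (\<lambda>i k. of_real (block_vector ss (r i)) * (unit_vec (r i) k :: 'a::real_normed_field)) \<le> 6"
proof -
  let ?a = "\<lambda>i. of_real (block_vector ss (r i)) :: 'a"
  let ?S = "PiE {..<N} (\<lambda>_. {-1, 1 :: 'a})"
  let ?p = "\<lambda>i. card (ss ! i)"
  define T where "T i = {t. t < N \<and> r t \<in> ss ! i}" for i
  have T: "ss ! i = r ` T i" if "i < length ss" for i
  proof -
    have "ss ! i \<subseteq> r ` {..<N}" using sub nth_mem[OF that] by blast
    then show ?thesis by (auto simp: T_def)
  qed
  have card_T: "card (T i) = ?p i" if "i < length ss" for i
    using T[OF that] r by (simp add: card_image inj_on_subset)
  have norm_le: "MR_norm m \<sigma> (lin_comb N \<epsilon> (\<lambda>i k. ?a i * unit_vec (r i) k)) \<le>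
      4 + (\<Sum>i<length ss. norm (\<Sum>t\<in>T i. \<epsilon> t) / ?p i)" if \<epsilon>: "\<epsilon> \<in> ?S" for \<epsilon>
  proof -
    \<comment> \<open>the signs as a function of the coordinate; the value outside \<open>r ` {..<N}\<close> is multiplied by 0\<close>
    define E where "E k = (if k \<in> r ` {..<N} then \<epsilon> (inv r k) else 1)" for k
    have "lin_comb N \<epsilon> (\<lambda>i k. ?a i * unit_vec (r i) k) =
        lin_comb N (\<lambda>i. \<epsilon> i * ?a i) (\<lambda>i. unit_vec (r i))"
      by (simp add: lin_comb_def mult.assoc)
    also have "\<dots> = (\<lambda>k. E k * of_real (block_vector ss k))"
    proof
      fix k
      have "block_vector ss k = 0" if "k \<notin> r ` {..<N}"
        using that sub by (intro block_vector_eq_0) auto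
      then show "lin_comb N (\<lambda>i. \<epsilon> i * ?a i) (\<lambda>i. unit_vec (r i)) k = E k * of_real (block_vector ss k)"
        using r by (auto simp: lin_comb_unit_vec_subseq E_def)
    qed
    finally have "MR_norm m \<sigma> (lin_comb N \<epsilon> (\<lambda>i k. ?a i * unit_vec (r i) k)) =
        MR_norm m \<sigma> (\<lambda>k. E k * of_real (block_vector ss k))" by simp
    also have "\<dots> \<le> 4 + (\<Sum>i<length ss. norm (\<Sum>j\<in>ss ! i. E j) / ?p i)"
    proof (rule MR_norm_signed_block_vector_le[OF ss])
      show "norm (E k) \<le> 1" for k
      proof (cases "k \<in> r ` {..<N}")
        case True
        then obtain i where "k = r i" "i < N" by auto
        then have "E k = \<epsilon> i" "\<epsilon> i \<in> {-1, 1}" using \<epsilon> r by (auto simp: E_def)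
        then show ?thesis by auto
      qed (simp add: E_def)
    qed
    also have "(\<Sum>i<length ss. norm (\<Sum>j\<in>ss ! i. E j) / ?p i) =
        (\<Sum>i<length ss. norm (\<Sum>t\<in>T i. \<epsilon> t) / ?p i)"
    proof (intro sum.cong refl)
      fix i assume "i \<in> {..<length ss}"
      then have i: "i < length ss" by simp
      have "(\<Sum>j\<in>ss ! i. E j) = (\<Sum>t\<in>T i. E (r t))"
        unfolding T[OF i] using r by (subst sum.reindex) (auto intro: inj_on_subset)
      also have "\<dots> = (\<Sum>t\<in>T i. \<epsilon> t)"
        using r by (intro sum.cong) (auto simp: E_def T_def)
      finally show "norm (\<Sum>j\<in>ss ! i. E j) / ?p i = norm (\<Sum>t\<in>T i. \<epsilon> t) / ?p i" by simp
    qed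
    finally show ?thesis .
  qed
  have card_S: "card ?S = 2 ^ N" by (simp add: card_sign_vectors)
  have "(\<Sum>\<epsilon>\<in>?S. MR_norm m \<sigma> (lin_comb N \<epsilon> (\<lambda>i k. ?a i * unit_vec (r i) k))) \<le>
      (\<Sum>\<epsilon>\<in>?S. 4 + (\<Sum>i<length ss. norm (\<Sum>t\<in>T i. \<epsilon> t) / ?p i))"
    by (intro sum_mono norm_le)
  also have "\<dots> = 2 ^ N * 4 + (\<Sum>i<length ss. (\<Sum>\<epsilon>\<in>?S. norm (\<Sum>t\<in>T i. \<epsilon> t)) / ?p i)"
    unfolding sum.distrib sum_divide_distrib by (simp add: card_S sum.swap[of _ ?S])
  also have "\<dots> \<le> 2 ^ N * 4 + (\<Sum>i<length ss. 2 ^ N * (1 / sqrt (?p i)))"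
  proof (intro add_left_mono sum_mono)
    fix i assume "i \<in> {..<length ss}"
    then have i: "i < length ss" by simp
    have "(\<Sum>\<epsilon>\<in>?S. norm (\<Sum>t\<in>T i. \<epsilon> t)) \<le> 2 ^ card {..<N} * sqrt (real (card (T i)))"
      by (rule sum_norm_sign_sum_le) (auto simp: T_def)
    then have "(\<Sum>\<epsilon>\<in>?S. norm (\<Sum>t\<in>T i. \<epsilon> t)) / ?p i \<le> 2 ^ N * sqrt (?p i) / ?p i"
      by (intro divide_right_mono) (auto simp: card_T[OF i])
    also have "\<dots> = 2 ^ N * (1 / sqrt (?p i))"
      using MR_lists_nth(3)[OF ss i] by (simp add: field_simps)
    finally show "(\<Sum>\<epsilon>\<in>?S. norm (\<Sum>t\<in>T i. \<epsilon> t)) / ?p i \<le> 2 ^ N * (1 / sqrt (?p i))" .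
  qed
  also have "\<dots> = 2 ^ N * (4 + (\<Sum>i<length ss. 1 / sqrt (?p i)))"
    by (simp add: distrib_left sum_distrib_left)
  also have "\<dots> \<le> 2 ^ N * 6"
    using sum_list_inverse_sqrt_le_2[OF ss] by simp
  finally show ?thesis unfolding sign_average_def by (simp add: divide_le_eq)
qed

lemma not_RUD_subseq:
  fixes r :: "nat \<Rightarrow> nat"
  assumes "strict_mono r"
  shows "\<not> RUD (MR_space m \<sigma>) (MR_norm m \<sigma>) (\<lambda>n. unit_vec (r n) :: nat \<Rightarrow> 'a::real_normed_field)"
proof
  let ?u = "\<lambda>n. unit_vec (r n) :: nat \<Rightarrow> 'a"
  assume "RUD (MR_space m \<sigma>) (MR_norm m \<sigma>) ?u"
  then obtain C where C: "\<And>n a. MR_norm m \<sigma> (lin_comb n a ?u) \<le>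
      C * sign_average (MR_norm m \<sigma>) n (\<lambda>i k. a i * ?u i k)"
    unfolding RUD_def by blast
  have r: "inj r" using assms by (rule strict_mono_imp_inj_on)
  then have "infinite (range r)" using finite_imageD by blast
  moreover obtain n :: nat where n: "max C 0 * 6 < n" using reals_Archimedean2 by blast
  ultimately obtain ss where ss: "ss \<in> MR_lists m \<sigma>" "length ss = Suc n" "\<Union>(set ss) \<subseteq> range r"
    using MR_lists_in_infinite_set by blast
  have "finite (\<Union>(set ss))" using ss by (auto simp: MR_lists_def)
  then obtain J where J: "finite J" "\<Union>(set ss) = r ` J" using ss(3) by (metis finite_subset_image)
  then obtain N where "J \<subseteq> {..<N}" by (auto simp: finite_nat_iff_bounded)
  then have sub: "\<Union>(set ss) \<subseteq> r ` {..<N}" using J by auto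
  let ?a = "\<lambda>i. of_real (block_vector ss (r i)) :: 'a"
  let ?avg = "sign_average (MR_norm m \<sigma>) N (\<lambda>i k. ?a i * ?u i k)"
  have lin: "lin_comb N ?a ?u = (\<lambda>k. of_real (block_vector ss k))"
  proof
    fix k
    have "block_vector ss k = 0" if "k \<notin> r ` {..<N}"
      using that sub by (intro block_vector_eq_0) auto
    then show "lin_comb N ?a ?u k = of_real (block_vector ss k)"
      using r by (auto simp: lin_comb_unit_vec_subseq)
  qed
  have "real (Suc n) \<le> norm (list_functional ss (lin_comb N ?a ?u))"
    using list_functional_block_vector_ge[OF ss(1), where 'a = 'a] ss(2) by (simp add: lin)
  also have "\<dots> \<le> MR_norm m \<sigma> (lin_comb N ?a ?u)"
    by (rule MR_norm_ge(1)[OF lin_comb_in_MR_space ss(1)])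
  also have "\<dots> \<le> C * ?avg" by (rule C)
  also have "\<dots> \<le> max C 0 * ?avg"
  proof (rule mult_right_mono)
    have "lin_comb N \<epsilon> (\<lambda>i k. ?a i * ?u i k) \<in> MR_space m \<sigma>" for \<epsilon>
      using lin_comb_in_MR_space[of N "\<lambda>i. \<epsilon> i * ?a i" r] by (simp add: lin_comb_def mult.assoc)
    then show "0 \<le> ?avg"
      unfolding sign_average_def by (intro divide_nonneg_nonneg sum_nonneg MR_norm_nonneg) auto
  qed simp
  also have "\<dots> \<le> max C 0 * 6"
    by (intro mult_left_mono sign_average_block_vector_le[OF ss(1) r sub]) simp
  finally show False using n by simp
qed

end

theorem theorem4p2:
  fixes \<delta> :: real and m :: "nat \<Rightarrow> nat" and \<sigma> :: "nat set \<Rightarrow> nat"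
  assumes "0 < \<delta>" and "\<delta> < 1"
    and "strict_mono m" and "\<And>n. 0 < m n"
    and "(\<Sum>j. \<Sum>k. if k = j then 0
            else ennreal (sqrt (min (real (m j) / real (m k)) (real (m k) / real (m j)))))
         \<le> ennreal \<delta>"
    and "inj_on \<sigma> {s. finite s}"
    and "\<sigma> ` {s. finite s} \<subseteq> m ` {1..}"
    and "\<And>s. finite s \<Longrightarrow> card s < \<sigma> s"
  shows "basic_sequence (MR_space m \<sigma>) (MR_norm m \<sigma>)
           (unit_vec :: nat \<Rightarrow> nat \<Rightarrow> 'a::real_normed_field) \<and>
         weakly_null (MR_space m \<sigma>) (MR_norm m \<sigma>) (unit_vec :: nat \<Rightarrow> nat \<Rightarrow> 'a) \<and>
         (\<forall>r. strict_mono r \<longrightarrow>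
            \<not> RUD (MR_space m \<sigma>) (MR_norm m \<sigma>) (\<lambda>n. unit_vec (r n) :: nat \<Rightarrow> 'a))"
proof -
  interpret maurey_rosenthal m \<sigma>
  proof
    have "ennreal \<delta> \<le> 1" using assms(2) by simp
    with assms(5) show "(\<Sum>j. \<Sum>k. if k = j then 0
        else ennreal (sqrt (min (real (m j) / real (m k)) (real (m k) / real (m j))))) \<le> 1"
      by (rule order_trans)
  qed (use assms in auto)
  show ?thesis
    using basic_sequence_unit_vec weakly_null_unit_vec not_RUD_subseq by blast
qed

end
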